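(* Let $A=\mathbb{Z}/(l_1)\times\dots\times\mathbb{Z}/(l_s)$ be a finite abelian group and let $p$ be a prime such that $p\mid q-1$ for every prime divisor $q$ of the order of $A$. For every $i=1,\dots,s$ let $b_i$ be a non-degenerate symmetric bilinear form over $(\mathbb{Z}/(p))^{n_i}$, let $f_i$ and $c_i$ be elements of order $p$ and $l_i$, respectively, in the orthogonal group of $b_i$, and let $\gamma_i\in\mathbb{Z}/(l_i)$ be an invertible element of (multiplicative) order $p$. Assume that $f_ic_i=c_i^{\gamma_i}f_i$ and that $\gamma_i-1$ is invertible in $\mathbb{Z}/(l_i)$, for every $i$. Let $B=T\rtimes_\circ\mathbb{Z}/(p)$ be the left brace constructed from these data (as described in the context). Then $B$ is simple if and only if $$\operatorname{Im}(c_i-\operatorname{id})+\operatorname{Im}(f_i-\operatorname{id})=(\mathbb{Z}/(p))^{n_i}\quad\text{for every } i=1,\dots,s.$$ In particular, a sufficient condition for $B$ to be simple is that $c_i-\operatorname{id}$ is invertible for every $i=1,\dots,s$.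
   Context: A left brace is a set $B$ with two operations $+$ and $\cdot$ such that $(B,+)$ is an abelian group, $(B,\cdot)$ is a group and $a\cdot(b+c)+a=a\cdot b+a\cdot c$ for all $a,b,c\in B$. The neutral elements of $(B,+)$ and $(B,\cdot)$ coincide and are denoted by $0$. The lambda map is $\lambda_a(b)=a\cdot b-a$. An ideal of $B$ is a normal subgroup $N$ of $(B,\cdot)$ such that $\lambda_b(a)\in N$ for all $b\in B$, $a\in N$. A non-zero left brace is simple if $\{0\}$ and $B$ are its only ideals. A trivial brace is a left brace with $a\cdot b=a+b$ for all $a,b$; any abelian group is regarded as a trivial brace in this way. The orthogonal group of $b_i$ is the group of automorphisms $g$ of $(\mathbb{Z}/(p))^{n_i}$ with $b_i(g(u),g(v))=b_i(u,v)$ for all $u,v$. Construction of $B$. Let $n=n_1+\dots+n_s$ and let $T=(\mathbb{Z}/(p))^n\rtimes A$ be the semidirect product of the trivial braces $(\mathbb{Z}/(p))^n=\prod_i(\mathbb{Z}/(p))^{n_i}$ and $A$ via the action $\beta_{(a_1,\dots,a_s)}(u_1,\dots,u_s)=(c_1^{a_1}(u_1),\dots,c_s^{a_s}(u_s))$; i.e. addition in $T$ is componentwise and $(u,a)\cdot(v,a')=(u+\beta_a(v),a+a')$. For $\mu\in\mathbb{Z}/(p)$ define $\alpha_\mu\in\operatorname{Aut}(T,+,\cdot)$ by $$\alpha_\mu(u_1,\dots,u_s,a_1,\dots,a_s)=(f_1^\mu(u_1),\dots,f_s^\mu(u_s),\gamma_1^\mu a_1,\dots,\gamma_s^\mu a_s),$$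 and define $b\colon T\times T\to\mathbb{Z}/(p)$ by $b((u_1,\dots,u_s,a_1,\dots,a_s),(v_1,\dots,v_s,a'_1,\dots,a'_s))=\sum_{i=1}^sb_i(u_i,v_i)$. Then $B=T\rtimes_\circ\mathbb{Z}/(p)$ is the asymmetric product of $T$ by the trivial brace $\mathbb{Z}/(p)$ via $b$ and $\alpha$, that is, the left brace on the set $T\times\mathbb{Z}/(p)$ with operations $$(t,\mu)+(t',\mu')=(t+t',\;\mu+\mu'+b(t,t')),\qquad (t,\mu)\cdot(t',\mu')=(t\cdot\alpha_\mu(t'),\;\mu+\mu').$$ *)

theory Defs
  imports "HOL-Algebra.Algebra" "HOL-Number_Theory.Residues"
begin

section \<open>Left braces\<close>

text \<open>A left brace is carried by a record of type \<open>ring\<close>: \<open>\<oplus>\<close> and \<open>\<zero>\<close> belong to the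
  additive group, \<open>\<otimes>\<close> and \<open>\<one>\<close> to the multiplicative group. That \<open>\<zero> = \<one>\<close> is a
  consequence of the axioms.\<close>

locale left_brace = abelian_group B + group B for B (structure) +
  assumes brace_compat:
    "\<lbrakk>a \<in> carrier B; b \<in> carrier B; c \<in> carrier B\<rbrakk>
      \<Longrightarrow> a \<otimes> (b \<oplus> c) \<oplus> a = a \<otimes> b \<oplus> a \<otimes> c"

definition lambda_map :: "('a, 'm) ring_scheme \<Rightarrow> 'a \<Rightarrow> 'a \<Rightarrow> 'a" where
  "lambda_map B a b = (a \<otimes>\<^bsub>B\<^esub> b) \<ominus>\<^bsub>B\<^esub> a"

definition brace_ideal :: "'a set \<Rightarrow> ('a, 'm) ring_scheme \<Rightarrow> bool" where
  "brace_ideal N B \<longleftrightarrow> N \<lhd> B \<and> (\<forall>b\<in>carrier B. \<forall>a\<in>N. lambda_map B b a \<in> N)"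

definition simple_left_brace :: "('a, 'm) ring_scheme \<Rightarrow> bool" where
  "simple_left_brace B \<longleftrightarrow>
     left_brace B \<and> carrier B \<noteq> {\<zero>\<^bsub>B\<^esub>} \<and>
     (\<forall>N. brace_ideal N B \<longrightarrow> N = {\<zero>\<^bsub>B\<^esub>} \<or> N = carrier B)"

definition trivial_brace :: "('a, 'm) monoid_scheme \<Rightarrow> 'a ring" where
  "trivial_brace G =
     \<lparr>carrier = carrier G, monoid.mult = monoid.mult G, one = \<one>\<^bsub>G\<^esub>, ring.zero = \<one>\<^bsub>G\<^esub>, ring.add = monoid.mult G\<rparr>"

definition semidirect_brace ::
    "('a, 'm) ring_scheme \<Rightarrow> ('b, 'k) ring_scheme \<Rightarrow> ('b \<Rightarrow> 'a \<Rightarrow> 'a) \<Rightarrow> ('a \<times> 'b) ring" where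
  "semidirect_brace N H \<beta> =
     \<lparr>carrier = carrier N \<times> carrier H,
      monoid.mult = (\<lambda>(u, a) (v, a'). (u \<otimes>\<^bsub>N\<^esub> \<beta> a v, a \<otimes>\<^bsub>H\<^esub> a')),
      one = (\<one>\<^bsub>N\<^esub>, \<one>\<^bsub>H\<^esub>),
      ring.zero = (\<zero>\<^bsub>N\<^esub>, \<zero>\<^bsub>H\<^esub>),
      ring.add = (\<lambda>(u, a) (v, a'). (u \<oplus>\<^bsub>N\<^esub> v, a \<oplus>\<^bsub>H\<^esub> a'))\<rparr>"

text \<open>The \<open>zero\<close> field below is neutral because the maps \<open>b\<close> of interest satisfy
  \<open>b \<zero> t = b t \<zero> = \<zero>\<close>.\<close>

definition asymmetric_product ::
    "('a, 'm) ring_scheme \<Rightarrow> ('b, 'k) ring_scheme \<Rightarrow> ('a \<Rightarrow> 'a \<Rightarrow> 'b) \<Rightarrow> ('b \<Rightarrow> 'a \<Rightarrow> 'a)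
      \<Rightarrow> ('a \<times> 'b) ring" where
  "asymmetric_product T S b \<alpha> =
     \<lparr>carrier = carrier T \<times> carrier S,
      monoid.mult = (\<lambda>(t, \<mu>) (t', \<mu>'). (t \<otimes>\<^bsub>T\<^esub> \<alpha> \<mu> t', \<mu> \<otimes>\<^bsub>S\<^esub> \<mu>')),
      one = (\<one>\<^bsub>T\<^esub>, \<one>\<^bsub>S\<^esub>),
      ring.zero = (\<zero>\<^bsub>T\<^esub>, \<zero>\<^bsub>S\<^esub>),
      ring.add = (\<lambda>(t, \<mu>) (t', \<mu>'). (t \<oplus>\<^bsub>T\<^esub> t', \<mu> \<oplus>\<^bsub>S\<^esub> \<mu>' \<oplus>\<^bsub>S\<^esub> b t t'))\<rparr>"


section \<open>Forms and orthogonal groups over the integers modulo \<open>p\<close>\<close>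

text \<open>The elements of \<open>\<int>/(m)\<close>, both in \<^const>\<open>integer_mod_group\<close> (the additive group, written
  multiplicatively) and in \<^const>\<open>residue_ring\<close>, are the integers in \<open>{0..<m}\<close>.
  The group \<open>(\<int>/(p))\<^sup>n\<close> is likewise written multiplicatively.\<close>

definition zp_space :: "nat \<Rightarrow> nat \<Rightarrow> (nat \<Rightarrow> int) monoid" where
  "zp_space p n = product_group {1..n} (\<lambda>_. integer_mod_group p)"

definition zp_scale :: "nat \<Rightarrow> nat \<Rightarrow> int \<Rightarrow> (nat \<Rightarrow> int) \<Rightarrow> nat \<Rightarrow> int" where
  "zp_scale p n k u = (\<lambda>j\<in>{1..n}. (k * u j) mod int p)"

definition zp_linear_form :: "nat \<Rightarrow> nat \<Rightarrow> ((nat \<Rightarrow> int) \<Rightarrow> int) \<Rightarrow> bool" where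
  "zp_linear_form p n h \<longleftrightarrow>
     h \<in> hom (zp_space p n) (integer_mod_group p) \<and>
     (\<forall>k\<in>{0..<int p}. \<forall>u\<in>carrier (zp_space p n). h (zp_scale p n k u) = (k * h u) mod int p)"

definition symmetric_bilinear_form ::
    "nat \<Rightarrow> nat \<Rightarrow> ((nat \<Rightarrow> int) \<Rightarrow> (nat \<Rightarrow> int) \<Rightarrow> int) \<Rightarrow> bool" where
  "symmetric_bilinear_form p n b \<longleftrightarrow>
     (\<forall>v\<in>carrier (zp_space p n). zp_linear_form p n (\<lambda>u. b u v)) \<and>
     (\<forall>u\<in>carrier (zp_space p n). zp_linear_form p n (\<lambda>v. b u v)) \<and>
     (\<forall>u\<in>carrier (zp_space p n). \<forall>v\<in>carrier (zp_space p n). b u v = b v u)"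

definition nondegenerate_form ::
    "nat \<Rightarrow> nat \<Rightarrow> ((nat \<Rightarrow> int) \<Rightarrow> (nat \<Rightarrow> int) \<Rightarrow> int) \<Rightarrow> bool" where
  "nondegenerate_form p n b \<longleftrightarrow>
     (\<forall>u\<in>carrier (zp_space p n).
        (\<forall>v\<in>carrier (zp_space p n). b u v = 0) \<longrightarrow> u = \<one>\<^bsub>zp_space p n\<^esub>)"

definition orthogonal_group ::
    "nat \<Rightarrow> nat \<Rightarrow> ((nat \<Rightarrow> int) \<Rightarrow> (nat \<Rightarrow> int) \<Rightarrow> int) \<Rightarrow> ((nat \<Rightarrow> int) \<Rightarrow> nat \<Rightarrow> int) monoid"
  where
  "orthogonal_group p n b =
     AutoGroup (zp_space p n)
       \<lparr>carrier := {g \<in> auto (zp_space p n).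
          \<forall>u\<in>carrier (zp_space p n). \<forall>v\<in>carrier (zp_space p n). b (g u) (g v) = b u v}\<rparr>"

text \<open>The endomorphism \<open>g - id\<close> of \<open>(\<int>/(p))\<^sup>n\<close>.\<close>

definition minus_id :: "nat \<Rightarrow> nat \<Rightarrow> ((nat \<Rightarrow> int) \<Rightarrow> nat \<Rightarrow> int) \<Rightarrow> (nat \<Rightarrow> int) \<Rightarrow> nat \<Rightarrow> int" where
  "minus_id p n g =
     (\<lambda>u\<in>carrier (zp_space p n). g u \<otimes>\<^bsub>zp_space p n\<^esub> inv\<^bsub>zp_space p n\<^esub> u)"


section \<open>The brace \<open>T \<rtimes>\<^sub>\<circ> \<int>/(p)\<close>\<close>

text \<open>The element \<open>(u\<^sub>1, \<dots>, u\<^sub>s, a\<^sub>1, \<dots>, a\<^sub>s)\<close> of \<open>T\<close> is the pair \<open>(u, a)\<close> of functions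
  on \<open>{1..s}\<close>. Residues used as exponents are represented by their integer representatives.\<close>

definition brace_T ::
    "nat \<Rightarrow> nat \<Rightarrow> (nat \<Rightarrow> nat) \<Rightarrow> (nat \<Rightarrow> nat) \<Rightarrow>
     (nat \<Rightarrow> (nat \<Rightarrow> int) \<Rightarrow> (nat \<Rightarrow> int) \<Rightarrow> int) \<Rightarrow> (nat \<Rightarrow> (nat \<Rightarrow> int) \<Rightarrow> nat \<Rightarrow> int) \<Rightarrow>
     ((nat \<Rightarrow> nat \<Rightarrow> int) \<times> (nat \<Rightarrow> int)) ring" where
  "brace_T p s n l bf c =
     semidirect_brace
       (trivial_brace (product_group {1..s} (\<lambda>i. zp_space p (n i))))
       (trivial_brace (product_group {1..s} (\<lambda>i. integer_mod_group (l i))))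
       (\<lambda>a u. \<lambda>i\<in>{1..s}. (c i [^]\<^bsub>orthogonal_group p (n i) (bf i)\<^esub> a i) (u i))"

definition alpha_T ::
    "nat \<Rightarrow> nat \<Rightarrow> (nat \<Rightarrow> nat) \<Rightarrow> (nat \<Rightarrow> nat) \<Rightarrow>
     (nat \<Rightarrow> (nat \<Rightarrow> int) \<Rightarrow> (nat \<Rightarrow> int) \<Rightarrow> int) \<Rightarrow> (nat \<Rightarrow> (nat \<Rightarrow> int) \<Rightarrow> nat \<Rightarrow> int) \<Rightarrow>
     (nat \<Rightarrow> int) \<Rightarrow> int \<Rightarrow>
     (nat \<Rightarrow> nat \<Rightarrow> int) \<times> (nat \<Rightarrow> int) \<Rightarrow> (nat \<Rightarrow> nat \<Rightarrow> int) \<times> (nat \<Rightarrow> int)" where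
  "alpha_T p s n l bf f \<gamma> \<mu> = (\<lambda>(u, a).
     (\<lambda>i\<in>{1..s}. (f i [^]\<^bsub>orthogonal_group p (n i) (bf i)\<^esub> \<mu>) (u i),
      \<lambda>i\<in>{1..s}. (\<gamma> i [^]\<^bsub>residue_ring (int (l i))\<^esub> \<mu>) \<otimes>\<^bsub>residue_ring (int (l i))\<^esub> a i))"

definition form_T ::
    "nat \<Rightarrow> nat \<Rightarrow> (nat \<Rightarrow> (nat \<Rightarrow> int) \<Rightarrow> (nat \<Rightarrow> int) \<Rightarrow> int) \<Rightarrow>
     (nat \<Rightarrow> nat \<Rightarrow> int) \<times> (nat \<Rightarrow> int) \<Rightarrow> (nat \<Rightarrow> nat \<Rightarrow> int) \<times> (nat \<Rightarrow> int) \<Rightarrow> int" where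
  "form_T p s bf = (\<lambda>(u, a) (v, a'). (\<Sum>i=1..s. bf i (u i) (v i)) mod int p)"

definition brace_B ::
    "nat \<Rightarrow> nat \<Rightarrow> (nat \<Rightarrow> nat) \<Rightarrow> (nat \<Rightarrow> nat) \<Rightarrow>
     (nat \<Rightarrow> (nat \<Rightarrow> int) \<Rightarrow> (nat \<Rightarrow> int) \<Rightarrow> int) \<Rightarrow>
     (nat \<Rightarrow> (nat \<Rightarrow> int) \<Rightarrow> nat \<Rightarrow> int) \<Rightarrow> (nat \<Rightarrow> (nat \<Rightarrow> int) \<Rightarrow> nat \<Rightarrow> int) \<Rightarrow>
     (nat \<Rightarrow> int) \<Rightarrow> (((nat \<Rightarrow> nat \<Rightarrow> int) \<times> (nat \<Rightarrow> int)) \<times> int) ring" where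
  "brace_B p s n l bf f c \<gamma> =
     asymmetric_product (brace_T p s n l bf c) (trivial_brace (integer_mod_group p))
       (form_T p s bf) (alpha_T p s n l bf f \<gamma>)"

end

theory Submission
  imports Defs
begin

text \<open>Write an element of \<open>B\<close> as \<open>((u, a), \<mu>)\<close>, and let \<open>V i\<close> be the \<open>i\<close>-th quadratic space.
  The proof is carried by the operation \<open>x * y = x \<cdot> y - x - y\<close>. It measures how far \<open>\<lambda>\<^sub>x\<close> is from
  fixing \<open>y\<close>, and an ideal that contains \<open>x\<close> or \<open>y\<close> contains \<open>x * y\<close>
  (\<open>left_brace.ideal_star_closed\<close>). In \<open>B\<close> it is given by
  \<open>((u, a), \<mu>) * ((v, a'), \<mu>') = ((c\<^sup>a f\<^sup>\<mu> v - v, \<gamma>\<^sup>\<mu> a' - a'), \<nu>)\<close> with an explicit \<open>\<nu>\<close> (\<open>star_B\<close>).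

  Suppose that \<open>Im(c\<^sub>i - id) + Im(f\<^sub>i - id) = V i\<close> for all \<open>i\<close>, and let \<open>N\<close> be a non-zero ideal.
  The spaces \<open>V i\<close> act on \<open>B\<close> as transvections, \<open>((w, 0), 0) * ((u, a), \<mu>) = ((0, 0), - b(w, u))\<close>,
  so by non-degeneracy \<open>N\<close> meets the last factor \<open>\<int>/(p)\<close> non-trivially as soon as it contains an
  element with \<open>u \<noteq> 0\<close>. If it contains an element with \<open>u = 0\<close> and \<open>a \<noteq> 0\<close>, then
  \<open>c\<^sub>i\<^sup>a f\<^sub>i\<^sup>\<mu>\<close> moves some vector for some \<open>i\<close>, because \<open>\<langle>c\<^sub>i\<rangle>\<close> and \<open>\<langle>f\<^sub>i\<rangle>\<close> intersect trivially
  (\<open>act_faithful\<close>), and a star product with that vector leads back to the first case. Hence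
  \<open>N\<close> always contains the last factor (\<open>ideal_meets_last_factor\<close>, \<open>last_factor_subset_ideal\<close>). From there
  the star formula climbs up: \<open>\<gamma>\<^sub>i - 1\<close> is invertible, so \<open>((0, 0), 1) * ((0, a'), 0)\<close> yields
  the factor \<open>A\<close>, and then the images of \<open>c\<^sub>i - id\<close> and \<open>f\<^sub>i - id\<close> yield all of \<open>V i\<close>
  (\<open>ideal_eq_carrier\<close>).

  Conversely, \<open>W\<^sub>i = Im(c\<^sub>i - id) + Im(f\<^sub>i - id)\<close> is a subgroup of \<open>V i\<close> on whose quotient \<open>c\<^sub>i\<close> and
  \<open>f\<^sub>i\<close> act trivially. So \<open>((u, a), \<mu>) \<mapsto> u\<^sub>i + W\<^sub>i\<close> is a homomorphism for both operations, and its
  kernel is an ideal (\<open>displacement_ideal\<close>). It contains the last factor \<open>\<int>/(p)\<close>, so it is non-zero,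
  and in a simple \<open>B\<close> this forces \<open>W\<^sub>i = V i\<close>.

  That \<open>B\<close> is a left brace at all follows from two general product constructions
  (\<open>left_brace_semidirect_brace\<close>, \<open>left_brace_asymmetric_product\<close>), whose hypotheses reduce to
  \<open>f\<^sub>i\<^sup>\<mu> c\<^sub>i\<^sup>a = c\<^sub>i^(\<gamma>\<^sub>i^\<mu> a) f\<^sub>i\<^sup>\<mu>\<close> and to the orthogonality of \<open>c\<^sub>i\<close> and \<open>f\<^sub>i\<close>.\<close>

section \<open>Star products and ideals of left braces\<close>

definition brace_star :: "('a, 'm) ring_scheme \<Rightarrow> 'a \<Rightarrow> 'a \<Rightarrow> 'a" where
  "brace_star B x y = x \<otimes>\<^bsub>B\<^esub> y \<ominus>\<^bsub>B\<^esub> x \<ominus>\<^bsub>B\<^esub> y"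

context left_brace
begin

lemma add_left_cancel_iff:
  "\<lbrakk>x \<in> carrier B; y \<in> carrier B; z \<in> carrier B\<rbrakk> \<Longrightarrow> x \<oplus> y = x \<oplus> z \<longleftrightarrow> y = z"
  by simp

lemma zero_eq_one: "\<zero> = \<one>"
  using brace_compat[of \<one> \<one> \<one>] by (simp add: add.l_cancel_one')

lemma lambda_closed:
  "\<lbrakk>a \<in> carrier B; b \<in> carrier B\<rbrakk> \<Longrightarrow> lambda_map B a b \<in> carrier B"
  by (simp add: lambda_map_def)

lemma add_lambda:
  "\<lbrakk>a \<in> carrier B; b \<in> carrier B\<rbrakk> \<Longrightarrow> a \<oplus> lambda_map B a b = a \<otimes> b"
  by (simp add: lambda_map_def minus_eq a_ac r_neg r_neg2)

lemma lambda_eqI: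
  assumes "a \<in> carrier B" "b \<in> carrier B" "d \<in> carrier B" "a \<otimes> b = a \<oplus> d"
  shows "lambda_map B a b = d"
  using assms add_lambda lambda_closed add_left_cancel_iff by metis

lemma lambda_add:
  assumes "a \<in> carrier B" "b \<in> carrier B" "c \<in> carrier B"
  shows "lambda_map B a (b \<oplus> c) = lambda_map B a b \<oplus> lambda_map B a c"
proof (rule lambda_eqI)
  let ?b = "lambda_map B a b" and ?c = "lambda_map B a c"
  have closed: "?b \<in> carrier B" "?c \<in> carrier B"
    using assms by (auto intro: lambda_closed)
  have "a \<oplus> (a \<otimes> (b \<oplus> c)) = (a \<otimes> b) \<oplus> (a \<otimes> c)"
    using brace_compat[OF assms] assms by (simp add: a_comm)
  also have "\<dots> = (a \<oplus> ?b) \<oplus> (a \<oplus> ?c)"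
    using assms by (simp add: add_lambda)
  also have "\<dots> = a \<oplus> (a \<oplus> (?b \<oplus> ?c))"
    using assms closed by (simp add: a_ac)
  finally show "a \<otimes> (b \<oplus> c) = a \<oplus> (?b \<oplus> ?c)"
    using assms closed by simp
qed (use assms in \<open>auto intro: lambda_closed\<close>)

text \<open>With the preceding lemma, \<open>\<lambda>\<close> is an action of the multiplicative group by endomorphisms of the
  additive one. Both laws are the brace axiom, read after adding \<open>a\<close> to both sides.\<close>

lemma lambda_mult:
  assumes "a \<in> carrier B" "b \<in> carrier B" "c \<in> carrier B"
  shows "lambda_map B (a \<otimes> b) c = lambda_map B a (lambda_map B b c)"
proof (rule lambda_eqI)
  let ?d = "lambda_map B b c"
  have d: "?d \<in> carrier B"
    using assms by (auto intro: lambda_closed)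
  have "a \<oplus> (a \<otimes> b \<otimes> c) = a \<oplus> (a \<otimes> (b \<oplus> ?d))"
    using assms by (simp add: add_lambda m_assoc)
  also have "\<dots> = (a \<otimes> b) \<oplus> (a \<otimes> ?d)"
    using brace_compat[of a b ?d] assms d by (simp add: a_comm)
  also have "\<dots> = (a \<otimes> b) \<oplus> (a \<oplus> lambda_map B a ?d)"
    using assms d by (simp add: add_lambda)
  also have "\<dots> = a \<oplus> ((a \<otimes> b) \<oplus> lambda_map B a ?d)"
    using assms d lambda_closed[of a ?d] by (simp add: a_ac)
  finally show "a \<otimes> b \<otimes> c = a \<otimes> b \<oplus> lambda_map B a ?d"
    using assms d lambda_closed[of a ?d] by simp
qed (use assms in \<open>auto intro: lambda_closed\<close>)

text \<open>Star products are computed by guessing the result: \<open>x \<cdot> y = x + y + d\<close> avoids all additive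
  inverses, which are awkward in an asymmetric product.\<close>

lemma brace_star_eqI:
  assumes "x \<in> carrier B" "y \<in> carrier B" "d \<in> carrier B" "x \<otimes> y = x \<oplus> y \<oplus> d"
  shows "brace_star B x y = d"
proof -
  have "brace_star B x y = x \<oplus> y \<oplus> d \<ominus> (x \<oplus> y)"
    using assms by (simp add: brace_star_def minus_eq minus_add a_assoc)
  also have "\<dots> = d"
    using assms(1-3) a_comm[of "x \<oplus> y" d] by (simp add: minus_eq a_assoc[of d "x \<oplus> y"] r_neg)
  finally show ?thesis .
qed

lemma lambda_eq_add_star:
  "\<lbrakk>x \<in> carrier B; y \<in> carrier B\<rbrakk> \<Longrightarrow> lambda_map B x y = y \<oplus> brace_star B x y"
  by (simp add: brace_star_def lambda_map_def minus_eq a_comm[of _ "\<ominus> y"] r_neg2)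

text \<open>Ideals are defined through the multiplicative group. They are additive subgroups because
  \<open>x + y = x \<cdot> \<lambda>\<^sub>z(y)\<close> for the multiplicative inverse \<open>z\<close> of \<open>x\<close>, and because \<open>\<lambda>\<^sub>y\<close> sends the
  multiplicative inverse of \<open>y\<close> to \<open>- y\<close>.\<close>

lemma ideal_add_closed:
  assumes N: "brace_ideal N B" and "x \<in> N" "y \<in> N"
  shows "x \<oplus> y \<in> N"
proof -
  have N': "subgroup N B" and lam: "\<And>b a. b \<in> carrier B \<Longrightarrow> a \<in> N \<Longrightarrow> lambda_map B b a \<in> N"
    using N by (auto simp: brace_ideal_def normal_def)
  have c: "x \<in> carrier B" "y \<in> carrier B"
    using assms subgroup.mem_carrier[OF N'] by auto
  have lam1: "lambda_map B \<one> y = y"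
    using c by (intro lambda_eqI) (auto simp flip: zero_eq_one)
  have "x \<otimes> lambda_map B (inv x) y = x \<oplus> lambda_map B x (lambda_map B (inv x) y)"
    using c lambda_closed by (simp add: add_lambda)
  also have "\<dots> = x \<oplus> y"
    using c lam1 by (simp flip: lambda_mult)
  finally show ?thesis
    using N' c assms lam[of "inv x" y] subgroup.m_closed[OF N'] by (metis inv_closed)
qed

lemma ideal_minus_closed:
  assumes N: "brace_ideal N B" and "x \<in> N" "y \<in> N"
  shows "x \<ominus> y \<in> N"
proof -
  have N': "subgroup N B" and lam: "\<And>b a. b \<in> carrier B \<Longrightarrow> a \<in> N \<Longrightarrow> lambda_map B b a \<in> N"
    using N by (auto simp: brace_ideal_def normal_def)
  have y: "y \<in> carrier B"
    using assms subgroup.mem_carrier[OF N'] by auto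
  have "lambda_map B y (inv y) = \<ominus> y"
    using y by (intro lambda_eqI) (auto simp: r_neg zero_eq_one)
  then have "\<ominus> y \<in> N"
    using lam[of y "inv y"] y assms subgroup.m_inv_closed[OF N'] by auto
  then show ?thesis
    using ideal_add_closed[OF N] assms by (simp add: minus_eq)
qed

text \<open>For \<open>y \<in> N\<close> the star product is \<open>\<lambda>\<^sub>x(y) - y\<close>. For \<open>x \<in> N\<close>, normality puts the conjugate
  \<open>n = inv y \<cdot> x \<cdot> y\<close> into \<open>N\<close>, and \<open>\<lambda>\<^sub>y(n) = x \<cdot> y - y\<close>.\<close>

lemma ideal_star_closed:
  assumes N: "brace_ideal N B" and c: "x \<in> carrier B" "y \<in> carrier B" and "x \<in> N \<or> y \<in> N"
  shows "brace_star B x y \<in> N"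
  using \<open>x \<in> N \<or> y \<in> N\<close>
proof
  assume "y \<in> N"
  then have "lambda_map B x y \<ominus> y \<in> N"
    using N c by (intro ideal_minus_closed) (auto simp: brace_ideal_def)
  then show ?thesis
    by (simp add: brace_star_def lambda_map_def)
next
  assume x: "x \<in> N"
  let ?n = "inv y \<otimes> x \<otimes> y"
  have "?n \<in> N"
    using N x c normal.inv_op_closed1[of N B y x] by (auto simp: brace_ideal_def)
  then have "lambda_map B y ?n \<ominus> x \<in> N"
    using N c x by (intro ideal_minus_closed) (auto simp: brace_ideal_def)
  moreover have "y \<otimes> ?n = x \<otimes> y"
    using c by (simp flip: m_assoc)
  moreover have "x \<otimes> y \<ominus> y \<ominus> x = x \<otimes> y \<ominus> x \<ominus> y"
    using c by (simp add: minus_eq a_ac)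
  ultimately show ?thesis
    by (simp add: brace_star_def lambda_map_def)
qed

end

section \<open>Products of braces\<close>

lemma left_brace_trivial_brace:
  assumes "comm_group G"
  shows "left_brace (trivial_brace G)"
proof -
  interpret G: comm_group G by fact
  interpret A: abelian_group "trivial_brace G"
    by (rule abelian_groupI)
      (auto simp: trivial_brace_def G.m_ac intro: G.l_inv_ex)
  interpret M: group "trivial_brace G"
    by (rule groupI)
      (auto simp: trivial_brace_def G.m_ac intro: G.l_inv_ex)
  show ?thesis
    by unfold_locales (auto simp: trivial_brace_def G.m_ac)
qed

text \<open>A group acting on a left brace by automorphisms of both operations. This is the common hypothesis
  of the semidirect and of the asymmetric product.\<close>

locale brace_action = H: group H + N: left_brace N
  for H :: "('b, 'k) monoid_scheme" and N :: "('a, 'm) ring_scheme"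
    and act :: "'b \<Rightarrow> 'a \<Rightarrow> 'a" +
  assumes act_closed: "\<lbrakk>h \<in> carrier H; u \<in> carrier N\<rbrakk> \<Longrightarrow> act h u \<in> carrier N"
    and act_mult: "\<lbrakk>h \<in> carrier H; u \<in> carrier N; v \<in> carrier N\<rbrakk>
      \<Longrightarrow> act h (u \<otimes>\<^bsub>N\<^esub> v) = act h u \<otimes>\<^bsub>N\<^esub> act h v"
    and act_add: "\<lbrakk>h \<in> carrier H; u \<in> carrier N; v \<in> carrier N\<rbrakk>
      \<Longrightarrow> act h (u \<oplus>\<^bsub>N\<^esub> v) = act h u \<oplus>\<^bsub>N\<^esub> act h v"
    and act_comp: "\<lbrakk>h \<in> carrier H; k \<in> carrier H; u \<in> carrier N\<rbrakk>
      \<Longrightarrow> act (h \<otimes>\<^bsub>H\<^esub> k) u = act h (act k u)"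
    and act_one: "u \<in> carrier N \<Longrightarrow> act \<one>\<^bsub>H\<^esub> u = u"
begin

text \<open>Both products have the multiplication of a semidirect product of groups and differ only in their
  addition, so the multiplicative group is treated once.\<close>

lemma group_semidirect:
  fixes Q :: "('a \<times> 'b, 'x) monoid_scheme"
  assumes "carrier Q = carrier N \<times> carrier H" "\<one>\<^bsub>Q\<^esub> = (\<one>\<^bsub>N\<^esub>, \<one>\<^bsub>H\<^esub>)"
    and mult: "\<And>u h v k. (u, h) \<otimes>\<^bsub>Q\<^esub> (v, k) = (u \<otimes>\<^bsub>N\<^esub> act h v, h \<otimes>\<^bsub>H\<^esub> k)"
  shows "group Q"
proof (rule groupI)
  fix x assume "x \<in> carrier Q"
  then obtain u h where x: "x = (u, h)" "u \<in> carrier N" "h \<in> carrier H"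
    using assms by auto
  let ?k = "inv\<^bsub>H\<^esub> h"
  have "(inv\<^bsub>N\<^esub> act ?k u, ?k) \<otimes>\<^bsub>Q\<^esub> x = \<one>\<^bsub>Q\<^esub>"
    using x by (simp add: assms act_closed)
  moreover have "(inv\<^bsub>N\<^esub> act ?k u, ?k) \<in> carrier Q"
    using x by (simp add: assms act_closed)
  ultimately show "\<exists>y\<in>carrier Q. y \<otimes>\<^bsub>Q\<^esub> x = \<one>\<^bsub>Q\<^esub>" by blast
qed (auto simp: assms act_closed act_mult act_comp act_one N.m_assoc H.m_assoc)

end

lemma left_brace_semidirect_brace:
  assumes "left_brace H" and "brace_action H N \<beta>"
  shows "left_brace (semidirect_brace N H \<beta>)"
proof -
  interpret H: left_brace H by fact
  interpret brace_action H N \<beta> by fact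
  let ?X = "semidirect_brace N H \<beta>"
  interpret X: group ?X
    by (rule group_semidirect) (auto simp: semidirect_brace_def)
  interpret A: abelian_group ?X
  proof (rule abelian_groupI)
    fix x assume "x \<in> carrier ?X"
    then show "\<exists>y\<in>carrier ?X. y \<oplus>\<^bsub>?X\<^esub> x = \<zero>\<^bsub>?X\<^esub>"
      by (intro bexI[of _ "(\<ominus>\<^bsub>N\<^esub> fst x, \<ominus>\<^bsub>H\<^esub> snd x)"])
        (auto simp: semidirect_brace_def H.l_neg N.l_neg)
  qed (auto simp: semidirect_brace_def H.a_ac N.a_ac)
  show ?thesis
    by unfold_locales
      (auto simp: semidirect_brace_def act_closed act_add N.brace_compat H.brace_compat)
qed

text \<open>With \<open>L = \<lambda>\<^sub>t\<close>, the cocycle terms on the two sides of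
  the brace axiom are \<open>b(u, v) + b(t + L u' + L v', t)\<close> and \<open>b(t + L u', t + L v')\<close> for \<open>u' = \<alpha>\<^sub>\<mu>(u)\<close> and
  \<open>v' = \<alpha>\<^sub>\<mu>(v)\<close>. They agree because \<open>b\<close> is biadditive, symmetric and invariant under both \<open>L\<close> and \<open>\<alpha>\<^sub>\<mu>\<close>.\<close>

lemma left_brace_asymmetric_product:
  assumes "comm_group S" and "brace_action S T \<alpha>"
    and b_closed: "\<And>t u. \<lbrakk>t \<in> carrier T; u \<in> carrier T\<rbrakk> \<Longrightarrow> b t u \<in> carrier S"
    and b_add: "\<And>t t' u. \<lbrakk>t \<in> carrier T; t' \<in> carrier T; u \<in> carrier T\<rbrakk>
      \<Longrightarrow> b (t \<oplus>\<^bsub>T\<^esub> t') u = b t u \<otimes>\<^bsub>S\<^esub> b t' u"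
    and b_sym: "\<And>t u. \<lbrakk>t \<in> carrier T; u \<in> carrier T\<rbrakk> \<Longrightarrow> b t u = b u t"
    and b_lambda: "\<And>t u v. \<lbrakk>t \<in> carrier T; u \<in> carrier T; v \<in> carrier T\<rbrakk>
      \<Longrightarrow> b (lambda_map T t u) (lambda_map T t v) = b u v"
    and b_act: "\<And>\<mu> u v. \<lbrakk>\<mu> \<in> carrier S; u \<in> carrier T; v \<in> carrier T\<rbrakk>
      \<Longrightarrow> b (\<alpha> \<mu> u) (\<alpha> \<mu> v) = b u v"
  shows "left_brace (asymmetric_product T (trivial_brace S) b \<alpha>)"
proof -
  interpret S: comm_group S by fact
  interpret brace_action S T \<alpha> by fact
  let ?X = "asymmetric_product T (trivial_brace S) b \<alpha>"
  note defs = asymmetric_product_def trivial_brace_def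
  have b_add': "b u (t \<oplus>\<^bsub>T\<^esub> t') = b u t \<otimes>\<^bsub>S\<^esub> b u t'"
    if "t \<in> carrier T" "t' \<in> carrier T" "u \<in> carrier T" for t t' u
    using that by (simp add: b_sym[of u] b_add)
  have b_zero: "b \<zero>\<^bsub>T\<^esub> u = \<one>\<^bsub>S\<^esub>" if "u \<in> carrier T" for u
    using b_add[of "\<zero>\<^bsub>T\<^esub>" "\<zero>\<^bsub>T\<^esub>" u] that b_closed[of "\<zero>\<^bsub>T\<^esub>" u] by simp
  interpret X: group ?X
    by (rule group_semidirect) (auto simp: defs)
  interpret A: abelian_group ?X
  proof (rule abelian_groupI)
    fix x assume "x \<in> carrier ?X"
    then obtain t \<mu> where x: "x = (t, \<mu>)" "t \<in> carrier T" "\<mu> \<in> carrier S"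
      by (auto simp: defs)
    let ?y = "(\<ominus>\<^bsub>T\<^esub> t, inv\<^bsub>S\<^esub> (\<mu> \<otimes>\<^bsub>S\<^esub> b (\<ominus>\<^bsub>T\<^esub> t) t))"
    have "?y \<in> carrier ?X" "?y \<oplus>\<^bsub>?X\<^esub> x = \<zero>\<^bsub>?X\<^esub>"
      using x S.l_inv[of "\<mu> \<otimes>\<^bsub>S\<^esub> b (\<ominus>\<^bsub>T\<^esub> t) t"] b_closed[of "\<ominus>\<^bsub>T\<^esub> t" t] by (simp_all add: defs N.l_neg S.m_assoc)
    then show "\<exists>y\<in>carrier ?X. y \<oplus>\<^bsub>?X\<^esub> x = \<zero>\<^bsub>?X\<^esub>" by blast
  next
    fix x y z assume "x \<in> carrier ?X" "y \<in> carrier ?X" "z \<in> carrier ?X"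
    then show "x \<oplus>\<^bsub>?X\<^esub> y \<oplus>\<^bsub>?X\<^esub> z = x \<oplus>\<^bsub>?X\<^esub> (y \<oplus>\<^bsub>?X\<^esub> z)"
      by (auto simp: defs b_closed b_add b_add' N.a_assoc S.m_ac)
  next
    fix x y assume "x \<in> carrier ?X" "y \<in> carrier ?X"
    then show "x \<oplus>\<^bsub>?X\<^esub> y = y \<oplus>\<^bsub>?X\<^esub> x"
      using b_sym by (auto simp: defs N.a_comm S.m_comm)
  qed (auto simp: defs b_closed b_zero)
  show ?thesis
  proof (unfold_locales, goal_cases)
    case (1 x y z)
    then obtain t \<mu> u \<nu> v \<rho> where
      xyz: "x = (t, \<mu>)" "y = (u, \<nu>)" "z = (v, \<rho>)" and
      c: "t \<in> carrier T" "u \<in> carrier T" "v \<in> carrier T"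
        "\<mu> \<in> carrier S" "\<nu> \<in> carrier S" "\<rho> \<in> carrier S"
      by (auto simp: defs)
    define u' v' where "u' = \<alpha> \<mu> u" and "v' = \<alpha> \<mu> v"
    have c': "u' \<in> carrier T" "v' \<in> carrier T"
      using c by (auto simp: u'_def v'_def act_closed)
    define L where "L = lambda_map T t"
    have L: "L w \<in> carrier T" "t \<otimes>\<^bsub>T\<^esub> w = t \<oplus>\<^bsub>T\<^esub> L w" if "w \<in> carrier T" for w
      using that c by (auto simp: L_def N.lambda_closed N.add_lambda)
    have L_add: "L (u' \<oplus>\<^bsub>T\<^esub> v') = L u' \<oplus>\<^bsub>T\<^esub> L v'"
      using c c' by (simp add: L_def N.lambda_add)
    have b_L: "b (L u') (L v') = b u v"
      using c c' by (simp add: L_def b_lambda) (simp add: u'_def v'_def b_act)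
    show ?case
      using c c' L_add b_L
      by (simp add: xyz defs act_add b_closed flip: u'_def v'_def)
        (simp add: L b_closed b_add b_add' b_sym[of "L u'" t] b_sym[of "L v'" t] N.a_ac S.m_ac)
  qed
qed

section \<open>Pairs of isometries generating a metacyclic group\<close>

lemma comm_group_product_group:
  assumes "\<And>i. i \<in> I \<Longrightarrow> comm_group (G i)"
  shows "comm_group (product_group I G)"
proof (rule group.group_comm_groupI)
  show "group (product_group I G)"
    using assms by (simp add: comm_group.axioms(2))
qed (use assms comm_monoid.m_comm in \<open>fastforce simp: comm_group_def intro!: restrict_ext\<close>)

lemma PiE_neqE:
  assumes "x \<in> Pi\<^sub>E I F" "y \<in> Pi\<^sub>E I F" "x \<noteq> y"
  obtains i where "i \<in> I" "x i \<noteq> y i"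
  using assms PiE_ext by blast

lemma comm_group_zp_space: "comm_group (zp_space p n)"
  by (simp add: zp_space_def comm_group_product_group)

lemma orthogonal_group_props:
  assumes "g \<in> carrier (orthogonal_group p n b)"
  shows "g \<in> hom (zp_space p n) (zp_space p n)" "g \<in> Bij (carrier (zp_space p n))"
    "u \<in> carrier (zp_space p n) \<Longrightarrow> g u \<in> carrier (zp_space p n)"
    "\<lbrakk>u \<in> carrier (zp_space p n); v \<in> carrier (zp_space p n)\<rbrakk>
      \<Longrightarrow> g (u \<otimes>\<^bsub>zp_space p n\<^esub> v) = g u \<otimes>\<^bsub>zp_space p n\<^esub> g v"
    "\<lbrakk>u \<in> carrier (zp_space p n); v \<in> carrier (zp_space p n)\<rbrakk> \<Longrightarrow> b (g u) (g v) = b u v"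
  using assms by (auto simp: orthogonal_group_def auto_def hom_def)

lemma orthogonal_group_fixes_zero:
  "g \<in> carrier (orthogonal_group p n b) \<Longrightarrow> g \<one>\<^bsub>zp_space p n\<^esub> = \<one>\<^bsub>zp_space p n\<^esub>"
  using hom_one[OF orthogonal_group_props(1)] comm_group_zp_space comm_group.axioms(2) by blast

lemma orthogonal_group_mult_apply:
  assumes "g \<in> carrier (orthogonal_group p n b)" "h \<in> carrier (orthogonal_group p n b)"
    and "u \<in> carrier (zp_space p n)"
  shows "(g \<otimes>\<^bsub>orthogonal_group p n b\<^esub> h) u = g (h u)"
  using assms orthogonal_group_props(2)[OF assms(1)] orthogonal_group_props(2)[OF assms(2)]
  by (simp add: orthogonal_group_def AutoGroup_def BijGroup_def compose_def)

lemma orthogonal_group_one_apply: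
  "u \<in> carrier (zp_space p n) \<Longrightarrow> \<one>\<^bsub>orthogonal_group p n b\<^esub> u = u"
  by (simp add: orthogonal_group_def AutoGroup_def BijGroup_def)

lemma orthogonal_group_eqI:
  assumes "g \<in> carrier (orthogonal_group p n b)" "h \<in> carrier (orthogonal_group p n b)"
    and "\<And>u. u \<in> carrier (zp_space p n) \<Longrightarrow> g u = h u"
  shows "g = h"
  using assms orthogonal_group_props(2)[of g] orthogonal_group_props(2)[of h]
  by (intro extensionalityI[of _ "carrier (zp_space p n)"]) (auto simp: Bij_def)

text \<open>The inverse of an isometry \<open>g\<close> is an isometry: apply invariance under \<open>g\<close> to the images of the
  two vectors under that inverse.\<close>

lemma group_orthogonal_group: "group (orthogonal_group p n b)"
proof -
  let ?V = "zp_space p n" and ?A = "AutoGroup (zp_space p n)"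
  interpret V: comm_group ?V by (rule comm_group_zp_space)
  interpret A: group ?A by (rule V.AutoGroup)
  let ?C = "{g \<in> auto ?V. \<forall>u\<in>carrier ?V. \<forall>v\<in>carrier ?V. b (g u) (g v) = b u v}"
  have [simp]: "carrier ?A = auto ?V"
    by (simp add: AutoGroup_def)
  have maps: "g u \<in> carrier ?V" if "g \<in> auto ?V" "u \<in> carrier ?V" for g u
    using that by (auto simp: auto_def hom_def)
  have app: "(g \<otimes>\<^bsub>?A\<^esub> h) u = g (h u)" if "g \<in> auto ?V" "h \<in> auto ?V" "u \<in> carrier ?V" for g h u
    using that by (simp add: auto_def AutoGroup_def BijGroup_def compose_def)
  have one: "\<one>\<^bsub>?A\<^esub> u = u" if "u \<in> carrier ?V" for u
    using that by (simp add: AutoGroup_def BijGroup_def)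
  have "subgroup ?C ?A"
  proof (rule A.subgroupI)
    show "?C \<noteq> {}"
      using A.one_closed by (auto simp: one intro!: exI[of _ "\<one>\<^bsub>?A\<^esub>"])
  next
    fix g assume g: "g \<in> ?C"
    then have g': "g \<in> auto ?V" "inv\<^bsub>?A\<^esub> g \<in> auto ?V"
      using A.inv_closed[of g] by auto
    have inv: "g ((inv\<^bsub>?A\<^esub> g) u) = u" if "u \<in> carrier ?V" for u
      using app[of g "inv\<^bsub>?A\<^esub> g" u] g' that A.r_inv[of g] by (simp add: one)
    have "b ((inv\<^bsub>?A\<^esub> g) u) ((inv\<^bsub>?A\<^esub> g) v) = b u v"
      if uv: "u \<in> carrier ?V" "v \<in> carrier ?V" for u v
    proof -
      have "b ((inv\<^bsub>?A\<^esub> g) u) ((inv\<^bsub>?A\<^esub> g) v)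
          = b (g ((inv\<^bsub>?A\<^esub> g) u)) (g ((inv\<^bsub>?A\<^esub> g) v))"
        using g maps[OF g'(2)] uv by simp
      then show ?thesis
        using inv uv by simp
    qed
    then show "inv\<^bsub>?A\<^esub> g \<in> ?C"
      using g' by simp
  next
    fix g h assume "g \<in> ?C" "h \<in> ?C"
    then show "g \<otimes>\<^bsub>?A\<^esub> h \<in> ?C"
      using A.m_closed[of g h] by (auto simp: app maps)
  qed auto
  then show ?thesis
    unfolding orthogonal_group_def by (rule subgroup.subgroup_is_group) (rule V.AutoGroup)
qed

text \<open>The relation says that conjugation by \<open>f\<close>, an endomorphism, sends \<open>c\<close> to \<open>c\<^sup>k\<close>; hence it sends
  \<open>c\<^sup>a\<close> to \<open>c\<^sup>k\<^sup>a\<close>, and the claim follows by iteration.\<close>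

lemma (in group) twisted_commute_pow:
  assumes f: "f \<in> carrier G" and c: "c \<in> carrier G" and rel: "f \<otimes> c = c [^] (k::int) \<otimes> f"
  shows "f [^] (m::nat) \<otimes> c [^] (a::int) = c [^] (k ^ m * a) \<otimes> f [^] m"
proof (induction m arbitrary: a)
  case 0
  then show ?case using assms by simp
next
  case (Suc m)
  let ?conj = "\<lambda>x. f \<otimes> x \<otimes> inv f"
  have hom: "group_hom G G ?conj"
  proof (intro group_hom.intro group_hom_axioms.intro homI is_group)
    fix x y assume xy: "x \<in> carrier G" "y \<in> carrier G"
    have "inv f \<otimes> (f \<otimes> (y \<otimes> inv f)) = y \<otimes> inv f"
      using f xy by (simp flip: m_assoc)
    then show "?conj (x \<otimes> y) = ?conj x \<otimes> ?conj y"
      using f xy by (simp add: m_assoc)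
  qed (use f in simp)
  have conj_c: "?conj c = c [^] k"
    using f c rel by (simp add: m_assoc)
  have step: "f \<otimes> c [^] a = c [^] (k * a) \<otimes> f" for a
  proof -
    have "?conj (c [^] a) = c [^] (k * a)"
      using group_hom.hom_int_pow[OF hom c, of a] c by (simp add: conj_c int_pow_pow)
    then show ?thesis
      using f c by (metis int_pow_closed inv_solve_right m_closed)
  qed
  have "f [^] Suc m \<otimes> c [^] a = f [^] m \<otimes> (f \<otimes> c [^] a)"
    using f c by (simp add: m_assoc)
  also have "\<dots> = (f [^] m \<otimes> c [^] (k * a)) \<otimes> f"
    using f c by (simp add: step m_assoc)
  also have "\<dots> = c [^] (k ^ Suc m * a) \<otimes> f [^] Suc m"
    using f c by (simp add: Suc.IH m_assoc mult_ac)
  finally show ?case .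
qed

text \<open>For automorphisms \<open>c\<close> and \<open>f\<close>, this is the smallest subgroup on whose quotient both act trivially.\<close>

definition displacement ::
    "nat \<Rightarrow> nat \<Rightarrow> ((nat \<Rightarrow> int) \<Rightarrow> nat \<Rightarrow> int) \<Rightarrow> ((nat \<Rightarrow> int) \<Rightarrow> nat \<Rightarrow> int) \<Rightarrow> (nat \<Rightarrow> int) set"
  where
  "displacement p n c f =
     (minus_id p n c ` carrier (zp_space p n))
       <#>\<^bsub>zp_space p n\<^esub> (minus_id p n f ` carrier (zp_space p n))"

text \<open>The hypotheses on one factor. The brace \<open>B\<close> is built from a finite family of such data with a
  common \<open>p\<close>, and all that its proof needs from a factor is established here.\<close>

locale metacyclic_isometries =
  fixes p n l :: nat and b :: "(nat \<Rightarrow> int) \<Rightarrow> (nat \<Rightarrow> int) \<Rightarrow> int"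
    and f c :: "(nat \<Rightarrow> int) \<Rightarrow> nat \<Rightarrow> int" and \<gamma> :: int
  assumes l_pos: "l > 0" and p_prime: "Factorial_Ring.prime p"
    and form: "symmetric_bilinear_form p n b" and nondegenerate: "nondegenerate_form p n b"
    and f_closed: "f \<in> carrier (orthogonal_group p n b)"
    and f_ord: "group.ord (orthogonal_group p n b) f = p"
    and c_closed: "c \<in> carrier (orthogonal_group p n b)"
    and c_ord: "group.ord (orthogonal_group p n b) c = l"
    and \<gamma>_unit: "\<gamma> \<in> Units (residue_ring (int l))"
    and \<gamma>_ord: "group.ord (units_of (residue_ring (int l))) \<gamma> = p"
    and twist: "f \<otimes>\<^bsub>orthogonal_group p n b\<^esub> c =
      (c [^]\<^bsub>orthogonal_group p n b\<^esub> \<gamma>) \<otimes>\<^bsub>orthogonal_group p n b\<^esub> f"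
    and \<gamma>_minus_one_unit: "\<gamma> \<ominus>\<^bsub>residue_ring (int l)\<^esub> \<one>\<^bsub>residue_ring (int l)\<^esub>
      \<in> Units (residue_ring (int l))"
begin

abbreviation "V \<equiv> zp_space p n"
abbreviation "OG \<equiv> orthogonal_group p n b"

sublocale V: comm_group V by (rule comm_group_zp_space)
sublocale O: group OG by (rule group_orthogonal_group)

lemma p_gt_1: "p > 1"
  using p_prime by (rule prime_gt_1_nat)

lemma form_range:
  assumes "u \<in> carrier V" "v \<in> carrier V"
  shows "0 \<le> b u v" "b u v < int p"
  using form assms p_gt_1
  by (auto simp: symmetric_bilinear_form_def zp_linear_form_def hom_def carrier_integer_mod_group Pi_def)

lemma form_add_left:
  "\<lbrakk>u \<in> carrier V; v \<in> carrier V; w \<in> carrier V\<rbrakk>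
    \<Longrightarrow> b (u \<otimes>\<^bsub>V\<^esub> v) w = (b u w + b v w) mod int p"
  using form by (auto simp: symmetric_bilinear_form_def zp_linear_form_def hom_def)

lemma form_sym: "\<lbrakk>u \<in> carrier V; v \<in> carrier V\<rbrakk> \<Longrightarrow> b u v = b v u"
  using form by (auto simp: symmetric_bilinear_form_def)

lemma form_zero_right: "u \<in> carrier V \<Longrightarrow> b u \<one>\<^bsub>V\<^esub> = 0"
  using form_add_left[of "\<one>\<^bsub>V\<^esub>" "\<one>\<^bsub>V\<^esub>" u] form_sym[of u "\<one>\<^bsub>V\<^esub>"]
    form_range[of "\<one>\<^bsub>V\<^esub>" u] by simp (smt (verit) zmod_trivial_iff mod_pos_pos_trivial mod_add_self1 minus_mod_self2)

lemma exists_nonorthogonal: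
  assumes "u \<in> carrier V" "u \<noteq> \<one>\<^bsub>V\<^esub>"
  obtains w where "w \<in> carrier V" "b w u \<noteq> 0"
  using nondegenerate assms form_sym unfolding nondegenerate_form_def by metis

text \<open>In \<^term>\<open>residue_ring 1\<close> the field \<open>one\<close> is \<open>1\<close>, which is no product modulo \<open>1\<close>, so that record
  has no units and the existence of \<open>\<gamma>\<close> excludes \<open>l = 1\<close>.\<close>

lemma l_gt_1: "l > 1"
proof (rule ccontr)
  assume "\<not> l > 1"
  then have "l = 1" using l_pos by simp
  then show False
    using \<gamma>_unit by (auto simp: Units_def residue_ring_def)
qed

sublocale R: residues "int l" "residue_ring (int l)"
  by unfold_locales (use l_gt_1 in auto)

lemma \<gamma>_nat_pow: "\<gamma> [^]\<^bsub>residue_ring (int l)\<^esub> (m::nat) = \<gamma> ^ m mod int l"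
proof -
  have "\<gamma> mod int l = \<gamma>"
    using \<gamma>_unit by (simp add: R.res_units_eq)
  then show ?thesis
    using R.pow_cong[of \<gamma> m] by metis
qed

lemma \<gamma>_int_pow:
  "0 \<le> \<mu> \<Longrightarrow> \<gamma> [^]\<^bsub>residue_ring (int l)\<^esub> (\<mu>::int) = \<gamma> ^ nat \<mu> mod int l"
  by (simp add: int_pow_def2 \<gamma>_nat_pow)

lemma \<gamma>_pow_eq_one_iff: "\<gamma> ^ m mod int l = 1 \<longleftrightarrow> p dvd m"
proof -
  interpret U: group "units_of (residue_ring (int l))" by (rule R.units_group)
  show ?thesis
    using U.pow_eq_id[of \<gamma> m] \<gamma>_unit
    by (simp add: \<gamma>_ord units_of_carrier units_of_one R.res_one_eq R.units_of_pow \<gamma>_nat_pow)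
qed

lemma \<gamma>_pow_mod: "\<gamma> ^ (m mod p) mod int l = \<gamma> ^ m mod int l"
proof -
  have "\<gamma> ^ m = (\<gamma> ^ p) ^ (m div p) * \<gamma> ^ (m mod p)"
    by (simp flip: power_mult power_add)
  moreover have "(\<gamma> ^ p) ^ (m div p) mod int l = 1"
    using \<gamma>_pow_eq_one_iff[of "p * (m div p)"] by (simp add: power_mult)
  ultimately show ?thesis
    by (metis mod_mult_left_eq mult_1)
qed

lemma \<gamma>_minus_one_solvable:
  obtains a' where "0 \<le> a'" "a' < int l" "(\<gamma> * a' - a') mod int l = a mod int l"
proof -
  let ?R = "residue_ring (int l)"
  have eq: "\<gamma> \<ominus>\<^bsub>?R\<^esub> \<one>\<^bsub>?R\<^esub> = (\<gamma> - 1) mod int l"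
    by (simp add: a_minus_def R.res_neg_eq R.res_add_eq R.res_one_eq mod_simps)
  obtain y where "(\<gamma> - 1) mod int l * y mod int l = 1"
    using \<gamma>_minus_one_unit unfolding Units_def eq by (auto simp: residue_ring_def)
  then have y: "(\<gamma> - 1) * y mod int l = 1"
    by (simp add: mod_simps)
  let ?a = "y * a mod int l"
  have "(\<gamma> * ?a - ?a) mod int l = ((\<gamma> - 1) * y * a) mod int l"
    by (simp add: mod_simps algebra_simps) (metis mod_diff_eq mod_mult_right_eq)
  also have "\<dots> = a mod int l"
    by (metis y mod_mult_left_eq mult_1)
  finally show thesis
    using that[of ?a] l_pos by simp
qed

lemma c_pow_mod: "c [^]\<^bsub>OG\<^esub> (a mod int l) = c [^]\<^bsub>OG\<^esub> a"
  using c_closed by (subst O.int_pow_eq) (auto simp: c_ord mod_eq_dvd_iff[symmetric])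

lemma f_pow_mod: "f [^]\<^bsub>OG\<^esub> (\<mu> mod int p) = f [^]\<^bsub>OG\<^esub> (\<mu>::int)"
  using f_closed by (subst O.int_pow_eq) (auto simp: f_ord mod_eq_dvd_iff[symmetric])

lemma f_pow_c_pow:
  assumes "0 \<le> \<mu>"
  shows "f [^]\<^bsub>OG\<^esub> \<mu> \<otimes>\<^bsub>OG\<^esub> c [^]\<^bsub>OG\<^esub> (a::int)
    = c [^]\<^bsub>OG\<^esub> (\<gamma> ^ nat \<mu> * a) \<otimes>\<^bsub>OG\<^esub> f [^]\<^bsub>OG\<^esub> \<mu>"
proof -
  have "f [^]\<^bsub>OG\<^esub> \<mu> = f [^]\<^bsub>OG\<^esub> nat \<mu>"
    using assms int_pow_int[of OG f "nat \<mu>"] by simp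
  then show ?thesis
    using O.twisted_commute_pow[OF f_closed c_closed twist, of "nat \<mu>" a] by argo
qed

text \<open>If \<open>c\<^sup>a f\<^sup>\<mu> = 1\<close>, then \<open>f\<^sup>\<mu>\<close> is a power of \<open>c\<close> and commutes with \<open>c\<close>. The twisted commutation
  then gives \<open>\<gamma>\<^sup>\<mu> = 1\<close> modulo \<open>l\<close>, so \<open>p\<close> divides \<open>\<mu>\<close>, and what remains is \<open>c\<^sup>a = 1\<close>.\<close>

lemma act_faithful:
  assumes a: "0 \<le> a" "a < int l" and \<mu>: "0 \<le> \<mu>" "\<mu> < int p"
    and one: "c [^]\<^bsub>OG\<^esub> a \<otimes>\<^bsub>OG\<^esub> f [^]\<^bsub>OG\<^esub> \<mu> = \<one>\<^bsub>OG\<^esub>"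
  shows "a = 0 \<and> \<mu> = 0"
proof -
  let ?ca = "c [^]\<^bsub>OG\<^esub> a" and ?f = "f [^]\<^bsub>OG\<^esub> \<mu>" and ?g = "\<gamma> ^ nat \<mu>"
  have cl: "?ca \<in> carrier OG" "?f \<in> carrier OG" "c [^]\<^bsub>OG\<^esub> ?g \<in> carrier OG"
    using f_closed c_closed by auto
  have f_eq: "?f = c [^]\<^bsub>OG\<^esub> (- a)"
    using one cl c_closed by (metis O.int_pow_neg O.inv_equality O.inv_inv O.inv_closed)
  have "c \<otimes>\<^bsub>OG\<^esub> ?f = c [^]\<^bsub>OG\<^esub> (1 + - a)"
    using c_closed by (subst O.int_pow_mult) (auto simp: f_eq)
  also have "\<dots> = ?f \<otimes>\<^bsub>OG\<^esub> c [^]\<^bsub>OG\<^esub> (1::int)"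
    using c_closed unfolding f_eq by (subst O.int_pow_mult[symmetric]) (auto simp: add.commute)
  also have "\<dots> = c [^]\<^bsub>OG\<^esub> ?g \<otimes>\<^bsub>OG\<^esub> ?f"
    using f_pow_c_pow[OF \<mu>(1), of 1] by simp
  finally have "c [^]\<^bsub>OG\<^esub> (1::int) = c [^]\<^bsub>OG\<^esub> ?g"
    using cl c_closed by simp
  then have "int l dvd ?g - 1"
    using c_closed by (subst (asm) O.int_pow_eq) (auto simp: c_ord)
  then have "?g mod int l = 1"
    using l_gt_1 by (metis mod_eq_dvd_iff int_ops(2) mod_less of_nat_mod)
  then have "p dvd nat \<mu>"
    by (simp add: \<gamma>_pow_eq_one_iff)
  then have mu: "\<mu> = 0"
    using \<mu> by (cases "\<mu> = 0") (auto dest: dvd_imp_le)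
  then have "?ca = \<one>\<^bsub>OG\<^esub>"
    using one cl by simp
  then have "int l dvd a"
    using c_closed by (simp add: O.int_pow_eq_id c_ord)
  then show ?thesis
    using a mu zdvd_not_zless[of a "int l"] by (cases "a = 0") auto
qed

abbreviation "W \<equiv> displacement p n c f"

lemma subgroup_minus_id_image:
  assumes "g \<in> carrier OG"
  shows "subgroup (minus_id p n g ` carrier V) V"
proof -
  have "minus_id p n g \<in> hom V V"
    using orthogonal_group_props(3,4)[OF assms]
    by (auto simp: hom_def minus_id_def V.inv_mult V.m_ac)
  then interpret group_hom V V "minus_id p n g"
    by unfold_locales
  show ?thesis by (rule img_is_subgroup)
qed

lemma subgroup_displacement: "subgroup W V"
  unfolding displacement_def
  by (intro V.mult_subgroups subgroup_minus_id_image c_closed f_closed)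

lemma displacement_memI:
  assumes "u \<in> carrier V" "v \<in> carrier V"
  shows "(c u \<otimes>\<^bsub>V\<^esub> inv\<^bsub>V\<^esub> u) \<otimes>\<^bsub>V\<^esub> (f v \<otimes>\<^bsub>V\<^esub> inv\<^bsub>V\<^esub> v) \<in> W"
  using assms by (force simp: displacement_def set_mult_def minus_id_def)

lemma displacement_cases:
  assumes "w \<in> W"
  obtains u v where "u \<in> carrier V" "v \<in> carrier V"
    "w = (c u \<otimes>\<^bsub>V\<^esub> inv\<^bsub>V\<^esub> u) \<otimes>\<^bsub>V\<^esub> (f v \<otimes>\<^bsub>V\<^esub> inv\<^bsub>V\<^esub> v)"
  using assms by (auto simp: displacement_def set_mult_def minus_id_def)

text \<open>Telescoping: \<open>g\<^bsup>m+1\<^esup> u - u = (g\<^sup>m(g u) - g u) + (g u - u)\<close>. This and the next lemma express that the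
  group generated by \<open>c\<close> and \<open>f\<close> acts trivially on the quotient of \<open>V\<close> by \<open>W\<close>.\<close>

lemma displacement_pow:
  assumes g: "g = c \<or> g = f" and "u \<in> carrier V"
  shows "(g [^]\<^bsub>OG\<^esub> (m::nat)) u \<otimes>\<^bsub>V\<^esub> inv\<^bsub>V\<^esub> u \<in> W"
  using \<open>u \<in> carrier V\<close>
proof (induction m arbitrary: u)
  case 0
  then show ?case
    using subgroup.one_closed[OF subgroup_displacement]
    by (simp add: orthogonal_group_one_apply)
next
  case (Suc m)
  have gO: "g \<in> carrier OG" using g f_closed c_closed by auto
  let ?h = "g [^]\<^bsub>OG\<^esub> m"
  have hO: "?h \<in> carrier OG" using gO by simp
  have cl: "g u \<in> carrier V" "?h (g u) \<in> carrier V"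
    using Suc.prems gO hO by (auto intro: orthogonal_group_props(3))
  have gu: "g u \<otimes>\<^bsub>V\<^esub> inv\<^bsub>V\<^esub> u \<in> W"
    using g displacement_memI[OF Suc.prems V.one_closed] displacement_memI[OF V.one_closed Suc.prems]
      cl orthogonal_group_fixes_zero f_closed c_closed Suc.prems
    by auto
  have "(g [^]\<^bsub>OG\<^esub> Suc m) u \<otimes>\<^bsub>V\<^esub> inv\<^bsub>V\<^esub> u
      = (?h (g u) \<otimes>\<^bsub>V\<^esub> inv\<^bsub>V\<^esub> g u) \<otimes>\<^bsub>V\<^esub> (g u \<otimes>\<^bsub>V\<^esub> inv\<^bsub>V\<^esub> u)"
    using cl Suc.prems gO hO
    by (simp add: orthogonal_group_mult_apply V.m_assoc V.inv_solve_left')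
      (metis V.inv_closed V.l_inv V.l_one V.m_assoc)
  then show ?case
    using Suc.IH[OF cl(1)] gu subgroup.m_closed[OF subgroup_displacement] by simp
qed

lemma displacement_act:
  assumes "0 \<le> a" "0 \<le> \<mu>" "u \<in> carrier V"
  shows "(c [^]\<^bsub>OG\<^esub> (a::int)) ((f [^]\<^bsub>OG\<^esub> (\<mu>::int)) u) \<otimes>\<^bsub>V\<^esub> inv\<^bsub>V\<^esub> u \<in> W"
proof -
  let ?v = "(f [^]\<^bsub>OG\<^esub> \<mu>) u"
  have fO: "f [^]\<^bsub>OG\<^esub> \<mu> \<in> carrier OG" and cO: "c [^]\<^bsub>OG\<^esub> a \<in> carrier OG"
    using f_closed c_closed by auto
  have v: "?v \<in> carrier V" and cv: "(c [^]\<^bsub>OG\<^esub> a) ?v \<in> carrier V"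
    using orthogonal_group_props(3)[OF fO] orthogonal_group_props(3)[OF cO] assms by auto
  have "((c [^]\<^bsub>OG\<^esub> a) ?v \<otimes>\<^bsub>V\<^esub> inv\<^bsub>V\<^esub> ?v) \<otimes>\<^bsub>V\<^esub> (?v \<otimes>\<^bsub>V\<^esub> inv\<^bsub>V\<^esub> u) \<in> W"
  proof (rule subgroup.m_closed[OF subgroup_displacement])
    have "c [^]\<^bsub>OG\<^esub> a = c [^]\<^bsub>OG\<^esub> nat a"
      using assms(1) int_pow_int[of OG c "nat a"] by simp
    then show "(c [^]\<^bsub>OG\<^esub> a) ?v \<otimes>\<^bsub>V\<^esub> inv\<^bsub>V\<^esub> ?v \<in> W"
      using displacement_pow[of c ?v "nat a"] v by metis
    have "f [^]\<^bsub>OG\<^esub> \<mu> = f [^]\<^bsub>OG\<^esub> nat \<mu>"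
      using assms(2) int_pow_int[of OG f "nat \<mu>"] by simp
    then show "?v \<otimes>\<^bsub>V\<^esub> inv\<^bsub>V\<^esub> u \<in> W"
      using displacement_pow[of f u "nat \<mu>"] assms(3) by metis
  qed
  moreover have "((c [^]\<^bsub>OG\<^esub> a) ?v \<otimes>\<^bsub>V\<^esub> inv\<^bsub>V\<^esub> ?v) \<otimes>\<^bsub>V\<^esub> (?v \<otimes>\<^bsub>V\<^esub> inv\<^bsub>V\<^esub> u)
      = (c [^]\<^bsub>OG\<^esub> a) ?v \<otimes>\<^bsub>V\<^esub> inv\<^bsub>V\<^esub> u"
    using v cv assms(3) by (metis V.inv_closed V.l_inv V.l_one V.m_assoc V.m_closed)
  ultimately show ?thesis by simp
qed

lemma displacement_eq_carrierI:
  assumes "minus_id p n c \<in> auto V"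
  shows "W = carrier V"
proof
  show "carrier V \<subseteq> W"
  proof
    fix w assume w: "w \<in> carrier V"
    have "minus_id p n c ` carrier V = carrier V"
      using assms by (simp add: auto_def Bij_def bij_betw_def)
    then obtain u where u: "u \<in> carrier V" "w = minus_id p n c u"
      using w by (metis imageE)
    have "f \<one>\<^bsub>V\<^esub> = \<one>\<^bsub>V\<^esub>"
      using f_closed by (rule orthogonal_group_fixes_zero)
    then show "w \<in> W"
      using displacement_memI[OF u(1) V.one_closed] u w by (simp add: minus_id_def)
  qed
qed (rule subgroup.subset[OF subgroup_displacement])

end

section \<open>The brace \<open>B\<close>\<close>

text \<open>Primality of \<open>p\<close> is assumed separately from the data of the factors, which say nothing about \<open>p\<close>
  when \<open>s = 0\<close>.\<close>

locale orthogonal_brace =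
  fixes p s :: nat and n l :: "nat \<Rightarrow> nat"
    and bf :: "nat \<Rightarrow> (nat \<Rightarrow> int) \<Rightarrow> (nat \<Rightarrow> int) \<Rightarrow> int"
    and f c :: "nat \<Rightarrow> (nat \<Rightarrow> int) \<Rightarrow> nat \<Rightarrow> int" and \<gamma> :: "nat \<Rightarrow> int"
  assumes prime: "Factorial_Ring.prime p"
    and factor: "\<And>i. i \<in> {1..s} \<Longrightarrow>
      metacyclic_isometries p (n i) (l i) (bf i) (f i) (c i) (\<gamma> i)"
begin

abbreviation "V i \<equiv> zp_space p (n i)"
abbreviation "OG i \<equiv> orthogonal_group p (n i) (bf i)"
abbreviation "VV \<equiv> product_group {1..s} V"
abbreviation "AA \<equiv> product_group {1..s} (\<lambda>i. integer_mod_group (l i))"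
abbreviation "T \<equiv> brace_T p s n l bf c"
abbreviation "B \<equiv> brace_B p s n l bf f c \<gamma>"

lemma p_gt_1: "p > 1"
  using prime by (rule prime_gt_1_nat)

lemma l_gt_1: "i \<in> {1..s} \<Longrightarrow> l i > 1"
  using metacyclic_isometries.l_gt_1[OF factor] .

lemma l_pos: "i \<in> {1..s} \<Longrightarrow> 0 < int (l i)"
  using l_gt_1[of i] by simp

lemma comm_group_VV: "comm_group VV"
  by (intro comm_group_product_group comm_group_zp_space)

lemma comm_group_AA: "comm_group AA"
  by (intro comm_group_product_group abelian_integer_mod_group)

lemma carrier_AA: "carrier AA = (\<Pi>\<^sub>E i\<in>{1..s}. {0..<int (l i)})"
proof -
  have "carrier (integer_mod_group (l i)) = {0..<int (l i)}" if "i \<in> {1..s}" for i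
    using l_gt_1[OF that] by (simp add: carrier_integer_mod_group)
  then show ?thesis by (auto intro!: PiE_cong)
qed

lemma VV_mem: "\<lbrakk>u \<in> carrier VV; i \<in> {1..s}\<rbrakk> \<Longrightarrow> u i \<in> carrier (V i)"
  by auto

lemma AA_mem: "\<lbrakk>a \<in> carrier AA; i \<in> {1..s}\<rbrakk> \<Longrightarrow> 0 \<le> a i \<and> a i < int (l i)"
  unfolding carrier_AA by auto

lemma c_pow_closed: "i \<in> {1..s} \<Longrightarrow> c i [^]\<^bsub>OG i\<^esub> (a::int) \<in> carrier (OG i)"
  using group.int_pow_closed[OF group_orthogonal_group] metacyclic_isometries.c_closed[OF factor] by blast

lemma f_pow_closed: "i \<in> {1..s} \<Longrightarrow> f i [^]\<^bsub>OG i\<^esub> (a::int) \<in> carrier (OG i)"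
  using group.int_pow_closed[OF group_orthogonal_group] metacyclic_isometries.f_closed[OF factor] by blast

lemmas c_pow = orthogonal_group_props(3-)[OF c_pow_closed]
lemmas f_pow = orthogonal_group_props(3-)[OF f_pow_closed]

lemma c_pow_add_apply:
  assumes i: "i \<in> {1..s}" and u: "u \<in> carrier (V i)"
  shows "(c i [^]\<^bsub>OG i\<^esub> ((a + a') mod int (l i))) u = (c i [^]\<^bsub>OG i\<^esub> a) ((c i [^]\<^bsub>OG i\<^esub> a') u)"
proof -
  have "c i [^]\<^bsub>OG i\<^esub> ((a + a') mod int (l i)) = c i [^]\<^bsub>OG i\<^esub> a \<otimes>\<^bsub>OG i\<^esub> c i [^]\<^bsub>OG i\<^esub> a'"
    using metacyclic_isometries.c_pow_mod[OF factor[OF i]] metacyclic_isometries.c_closed[OF factor[OF i]]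
      group.int_pow_mult[OF group_orthogonal_group] by metis
  then show ?thesis
    using i u by (simp add: orthogonal_group_mult_apply c_pow_closed)
qed

lemma f_pow_add_apply:
  assumes i: "i \<in> {1..s}" and u: "u \<in> carrier (V i)"
  shows "(f i [^]\<^bsub>OG i\<^esub> ((\<mu> + \<mu>') mod int p)) u = (f i [^]\<^bsub>OG i\<^esub> \<mu>) ((f i [^]\<^bsub>OG i\<^esub> \<mu>') u)"
proof -
  have "f i [^]\<^bsub>OG i\<^esub> ((\<mu> + \<mu>') mod int p) = f i [^]\<^bsub>OG i\<^esub> \<mu> \<otimes>\<^bsub>OG i\<^esub> f i [^]\<^bsub>OG i\<^esub> \<mu>'"
    using metacyclic_isometries.f_pow_mod[OF factor[OF i]] metacyclic_isometries.f_closed[OF factor[OF i]]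
      group.int_pow_mult[OF group_orthogonal_group] by metis
  then show ?thesis
    using i u by (simp add: orthogonal_group_mult_apply f_pow_closed)
qed

lemma f_pow_c_pow_apply:
  assumes i: "i \<in> {1..s}" and u: "u \<in> carrier (V i)" and "0 \<le> \<mu>"
  shows "(f i [^]\<^bsub>OG i\<^esub> \<mu>) ((c i [^]\<^bsub>OG i\<^esub> a) u)
    = (c i [^]\<^bsub>OG i\<^esub> (\<gamma> i ^ nat \<mu> * a mod int (l i))) ((f i [^]\<^bsub>OG i\<^esub> \<mu>) u)"
proof -
  have "f i [^]\<^bsub>OG i\<^esub> \<mu> \<otimes>\<^bsub>OG i\<^esub> c i [^]\<^bsub>OG i\<^esub> a
      = c i [^]\<^bsub>OG i\<^esub> (\<gamma> i ^ nat \<mu> * a mod int (l i)) \<otimes>\<^bsub>OG i\<^esub> f i [^]\<^bsub>OG i\<^esub> \<mu>"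
    using metacyclic_isometries.f_pow_c_pow[OF factor[OF i] \<open>0 \<le> \<mu>\<close>]
      metacyclic_isometries.c_pow_mod[OF factor[OF i]] by metis
  then show ?thesis
    using i u by (metis orthogonal_group_mult_apply c_pow_closed f_pow_closed)
qed

lemma T_simps:
  "carrier T = carrier VV \<times> carrier AA"
  "(u, a) \<otimes>\<^bsub>T\<^esub> (v, a') = (\<lambda>i\<in>{1..s}. u i \<otimes>\<^bsub>V i\<^esub> (c i [^]\<^bsub>OG i\<^esub> a i) (v i), \<lambda>i\<in>{1..s}. (a i + a' i) mod int (l i))"
  "(u, a) \<oplus>\<^bsub>T\<^esub> (v, a') = (\<lambda>i\<in>{1..s}. u i \<otimes>\<^bsub>V i\<^esub> v i, \<lambda>i\<in>{1..s}. (a i + a' i) mod int (l i))"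
  "\<one>\<^bsub>T\<^esub> = (\<lambda>i\<in>{1..s}. \<one>\<^bsub>V i\<^esub>, \<lambda>i\<in>{1..s}. 0)"
  "\<zero>\<^bsub>T\<^esub> = (\<lambda>i\<in>{1..s}. \<one>\<^bsub>V i\<^esub>, \<lambda>i\<in>{1..s}. 0)"
  by (auto simp: brace_T_def semidirect_brace_def trivial_brace_def intro!: restrict_ext)

lemma left_brace_T: "left_brace T"
proof -
  let ?\<beta> = "\<lambda>a u. \<lambda>i\<in>{1..s}. (c i [^]\<^bsub>OG i\<^esub> a i) (u i)"
  let ?N = "trivial_brace VV" and ?H = "trivial_brace AA"
  have H: "left_brace ?H" and N: "left_brace ?N"
    using comm_group_AA comm_group_VV by (auto intro: left_brace_trivial_brace)
  interpret H: left_brace ?H by fact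
  have "brace_action ?H ?N ?\<beta>"
  proof (intro brace_action.intro brace_action_axioms.intro H.is_group N)
    fix a u assume "a \<in> carrier ?H" "u \<in> carrier ?N"
    then show "?\<beta> a u \<in> carrier ?N"
      using VV_mem[of u] by (auto simp: trivial_brace_def restrict_PiE_iff c_pow)
  next
    fix a u v assume "a \<in> carrier ?H" "u \<in> carrier ?N" "v \<in> carrier ?N"
    then show "?\<beta> a (u \<otimes>\<^bsub>?N\<^esub> v) = ?\<beta> a u \<otimes>\<^bsub>?N\<^esub> ?\<beta> a v" "?\<beta> a (u \<oplus>\<^bsub>?N\<^esub> v) = ?\<beta> a u \<oplus>\<^bsub>?N\<^esub> ?\<beta> a v"
      using VV_mem[of u] VV_mem[of v] by (auto simp: trivial_brace_def c_pow  intro!: restrict_ext)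
  next
    fix a a' u assume "a \<in> carrier ?H" "a' \<in> carrier ?H" "u \<in> carrier ?N"
    then show "?\<beta> (a \<otimes>\<^bsub>?H\<^esub> a') u = ?\<beta> a (?\<beta> a' u)"
      using VV_mem[of u] by (auto simp: trivial_brace_def c_pow_add_apply  intro!: restrict_ext)
  next
    fix u assume "u \<in> carrier ?N"
    then show "?\<beta> \<one>\<^bsub>?H\<^esub> u = u"
      using VV_mem[of u] by (intro PiE_ext[of _ _ _ u])
        (auto simp: trivial_brace_def restrict_PiE_iff orthogonal_group_one_apply)
  qed
  then show ?thesis
    unfolding brace_T_def by (intro left_brace_semidirect_brace H)
qed

lemma lambda_T:
  assumes "(u, a) \<in> carrier T" "(v, a') \<in> carrier T"
  shows "lambda_map T (u, a) (v, a') = (\<lambda>i\<in>{1..s}. (c i [^]\<^bsub>OG i\<^esub> a i) (v i), a')"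
proof (rule left_brace.lambda_eqI[OF left_brace_T assms])
  show "(\<lambda>i\<in>{1..s}. (c i [^]\<^bsub>OG i\<^esub> a i) (v i), a') \<in> carrier T"
    using assms VV_mem[of v] by (auto simp: T_simps restrict_PiE_iff c_pow)
qed (auto simp: T_simps intro!: restrict_ext)

lemma alpha_T_eq:
  assumes "0 \<le> \<mu>"
  shows "alpha_T p s n l bf f \<gamma> \<mu> (u, a) =
    (\<lambda>i\<in>{1..s}. (f i [^]\<^bsub>OG i\<^esub> \<mu>) (u i), \<lambda>i\<in>{1..s}. \<gamma> i ^ nat \<mu> * a i mod int (l i))"
  using assms metacyclic_isometries.\<gamma>_int_pow[OF factor]
  by (auto simp: alpha_T_def residue_ring_def mod_simps intro!: restrict_ext)

lemma gamma_pow_mod: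
  assumes "i \<in> {1..s}" "0 \<le> \<mu>" "0 \<le> \<mu>'"
  shows "\<gamma> i ^ nat ((\<mu> + \<mu>') mod int p) * a mod int (l i)
    = \<gamma> i ^ nat \<mu> * (\<gamma> i ^ nat \<mu>' * a mod int (l i)) mod int (l i)"
proof -
  have "nat ((\<mu> + \<mu>') mod int p) = (nat \<mu> + nat \<mu>') mod p"
    using assms by (simp add: nat_mod_distrib nat_add_distrib)
  then have "\<gamma> i ^ nat ((\<mu> + \<mu>') mod int p) mod int (l i) = \<gamma> i ^ (nat \<mu> + nat \<mu>') mod int (l i)"
    using metacyclic_isometries.\<gamma>_pow_mod[OF factor[OF assms(1)]] by simp
  then have "\<gamma> i ^ nat ((\<mu> + \<mu>') mod int p) * a mod int (l i)
      = \<gamma> i ^ (nat \<mu> + nat \<mu>') * a mod int (l i)"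
    by (metis mod_mult_left_eq)
  then show ?thesis
    by (simp add: power_add mod_mult_right_eq mult.assoc)
qed

text \<open>The map \<open>\<alpha>\<^sub>\<mu>\<close> respects the multiplication of \<open>T\<close> exactly because moving \<open>f\<^sup>\<mu>\<close> past \<open>c\<^sup>a\<close> replaces
  \<open>a\<close> by \<open>\<gamma>\<^sup>\<mu> a\<close>, which is how \<open>\<alpha>\<^sub>\<mu>\<close> acts on the second component.\<close>

lemma brace_action_alpha: "brace_action (integer_mod_group p) T (alpha_T p s n l bf f \<gamma>)"
proof (intro brace_action.intro brace_action_axioms.intro left_brace_T group_integer_mod_group)
  let ?S = "integer_mod_group p" and ?\<alpha> = "alpha_T p s n l bf f \<gamma>"
  have S: "\<mu> \<in> carrier ?S \<longleftrightarrow> 0 \<le> \<mu> \<and> \<mu> < int p" for \<mu>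
    using p_gt_1 by (simp add: carrier_integer_mod_group)
  note T = T_simps carrier_AA carrier_product_group[of _ V]
  fix \<mu> x assume \<mu>: "\<mu> \<in> carrier ?S" and x: "x \<in> carrier T"
  obtain u a where xe: "x = (u, a)" by (cases x)
  show "?\<alpha> \<mu> x \<in> carrier T"
    using \<mu> x l_pos VV_mem[of u] by (auto simp: xe T S alpha_T_eq restrict_PiE_iff f_pow simp del: carrier_product_group One_nat_def)
  fix \<mu>' assume \<mu>': "\<mu>' \<in> carrier ?S"
  show "?\<alpha> (\<mu> \<otimes>\<^bsub>?S\<^esub> \<mu>') x = ?\<alpha> \<mu> (?\<alpha> \<mu>' x)"
    using \<mu> \<mu>' x VV_mem[of u]
    by (auto simp: xe T S alpha_T_eq f_pow_add_apply gamma_pow_mod  intro!: restrict_ext)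
next
  let ?S = "integer_mod_group p" and ?\<alpha> = "alpha_T p s n l bf f \<gamma>"
  have S: "\<mu> \<in> carrier ?S \<longleftrightarrow> 0 \<le> \<mu> \<and> \<mu> < int p" for \<mu>
    using p_gt_1 by (simp add: carrier_integer_mod_group)
  note T = T_simps carrier_AA carrier_product_group[of _ V]
  fix \<mu> x y assume \<mu>: "\<mu> \<in> carrier ?S" and xy: "x \<in> carrier T" "y \<in> carrier T"
  obtain u a v a' where e: "x = (u, a)" "y = (v, a')" by (cases x, cases y)
  show "?\<alpha> \<mu> (x \<otimes>\<^bsub>T\<^esub> y) = ?\<alpha> \<mu> x \<otimes>\<^bsub>T\<^esub> ?\<alpha> \<mu> y"
    using \<mu> xy VV_mem[of u] VV_mem[of v]
    by (auto simp: e T S alpha_T_eq f_pow c_pow f_pow_c_pow_apply  mod_simps distrib_left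
        intro!: restrict_ext)
  show "?\<alpha> \<mu> (x \<oplus>\<^bsub>T\<^esub> y) = ?\<alpha> \<mu> x \<oplus>\<^bsub>T\<^esub> ?\<alpha> \<mu> y"
    using \<mu> xy VV_mem[of u] VV_mem[of v]
    by (auto simp: e T S alpha_T_eq f_pow  mod_simps distrib_left intro!: restrict_ext)
next
  fix x assume x: "x \<in> carrier T"
  obtain u a where xe: "x = (u, a)" by (cases x)
  have "(\<lambda>i\<in>{1..s}. (f i [^]\<^bsub>OG i\<^esub> (0::int)) (u i)) = u"
    using x VV_mem[of u] by (intro PiE_ext[of _ "{1..s}" "\<lambda>i. carrier (V i)" u])
      (auto simp: xe T_simps restrict_PiE_iff orthogonal_group_one_apply)
  moreover have "(\<lambda>i\<in>{1..s}. \<gamma> i ^ nat 0 * a i mod int (l i)) = a"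
    using x AA_mem[of a] by (intro PiE_ext[of _ "{1..s}" "\<lambda>i. {0..<int (l i)}" a])
      (auto simp: xe T_simps carrier_AA restrict_PiE_iff simp del: carrier_product_group One_nat_def)
  ultimately show "alpha_T p s n l bf f \<gamma> \<one>\<^bsub>integer_mod_group p\<^esub> x = x"
    by (simp only: xe alpha_T_eq one_integer_mod_group order_refl)
qed


lemma left_brace_B: "left_brace B"
  unfolding brace_B_def
proof (rule left_brace_asymmetric_product[OF abelian_integer_mod_group brace_action_alpha])
  fix t u assume t: "t \<in> carrier T" and u: "u \<in> carrier T"
  show "form_T p s bf t u \<in> carrier (integer_mod_group p)"
    using p_gt_1 by (simp add: form_T_def carrier_integer_mod_group split: prod.split)
  have "(\<Sum>i=1..s. bf i (fst t i) (fst u i)) = (\<Sum>i=1..s. bf i (fst u i) (fst t i))"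
    using t u VV_mem[of "fst t"] VV_mem[of "fst u"]
    by (intro sum.cong metacyclic_isometries.form_sym[OF factor]) (auto simp: T_simps)
  then show "form_T p s bf t u = form_T p s bf u t"
    by (simp add: form_T_def split_beta)
  fix t' assume t': "t' \<in> carrier T"
  obtain x a y a' z a'' where e: "t = (x, a)" "u = (y, a')" "t' = (z, a'')"
    by (cases t, cases u, cases t')
  have "(\<Sum>i=1..s. bf i (x i \<otimes>\<^bsub>V i\<^esub> z i) (y i))
      = (\<Sum>i=1..s. (bf i (x i) (y i) + bf i (z i) (y i)) mod int p)"
    using t u t' metacyclic_isometries.form_add_left[OF factor] VV_mem
    by (intro sum.cong) (auto simp: e T_simps)
  then show "form_T p s bf (t \<oplus>\<^bsub>T\<^esub> t') u
      = form_T p s bf t u \<otimes>\<^bsub>integer_mod_group p\<^esub> form_T p s bf t' u"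
    by (simp add: e T_simps form_T_def mod_simps sum.distrib)
next
  fix t u v assume tuv: "t \<in> carrier T" "u \<in> carrier T" "v \<in> carrier T"
  obtain x a y a' z a'' where e: "t = (x, a)" "u = (y, a')" "v = (z, a'')"
    by (cases t, cases u, cases v)
  have "bf i ((c i [^]\<^bsub>OG i\<^esub> a i) (y i)) ((c i [^]\<^bsub>OG i\<^esub> a i) (z i)) = bf i (y i) (z i)"
    if "i \<in> {1..s}" for i
    using that tuv VV_mem[of y] VV_mem[of z] by (intro c_pow) (auto simp: e T_simps)
  then show "form_T p s bf (lambda_map T t u) (lambda_map T t v) = form_T p s bf u v"
    using tuv by (simp add: e lambda_T form_T_def)
next
  fix \<mu> u v assume \<mu>: "\<mu> \<in> carrier (integer_mod_group p)" and uv: "u \<in> carrier T" "v \<in> carrier T"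
  obtain y a' z a'' where e: "u = (y, a')" "v = (z, a'')"
    by (cases u, cases v)
  have "0 \<le> \<mu>"
    using \<mu> p_gt_1 by (simp add: carrier_integer_mod_group)
  moreover have "bf i ((f i [^]\<^bsub>OG i\<^esub> \<mu>) (y i)) ((f i [^]\<^bsub>OG i\<^esub> \<mu>) (z i)) = bf i (y i) (z i)"
    if "i \<in> {1..s}" for i
    using that uv VV_mem[of y] VV_mem[of z] by (intro f_pow) (auto simp: e T_simps)
  ultimately show "form_T p s bf (alpha_T p s n l bf f \<gamma> \<mu> u) (alpha_T p s n l bf f \<gamma> \<mu> v)
      = form_T p s bf u v"
    by (simp add: e alpha_T_eq form_T_def)
qed

sublocale B: left_brace B by (rule left_brace_B)

definition act :: "nat \<Rightarrow> int \<Rightarrow> int \<Rightarrow> (nat \<Rightarrow> int) \<Rightarrow> nat \<Rightarrow> int" where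
  "act i a \<mu> u = (c i [^]\<^bsub>OG i\<^esub> a) ((f i [^]\<^bsub>OG i\<^esub> \<mu>) u)"

lemma act_closed: "\<lbrakk>i \<in> {1..s}; u \<in> carrier (V i)\<rbrakk> \<Longrightarrow> act i a \<mu> u \<in> carrier (V i)"
  by (simp add: act_def c_pow f_pow)

lemma carrier_B:
  "((u, a), \<mu>) \<in> carrier B \<longleftrightarrow> u \<in> carrier VV \<and> a \<in> carrier AA \<and> 0 \<le> \<mu> \<and> \<mu> < int p"
  using p_gt_1 unfolding brace_B_def
  by (auto simp: asymmetric_product_def trivial_brace_def T_simps carrier_integer_mod_group
      simp del: carrier_product_group)

lemma B_cases:
  assumes "x \<in> carrier B"
  obtains u a \<mu> where "x = ((u, a), \<mu>)" "u \<in> carrier VV" "a \<in> carrier AA" "0 \<le> \<mu>" "\<mu> < int p"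
  using assms carrier_B by (metis prod.collapse)

lemma mult_B:
  "0 \<le> \<mu> \<Longrightarrow> ((u, a), \<mu>) \<otimes>\<^bsub>B\<^esub> ((v, a'), \<mu>') =
    ((\<lambda>i\<in>{1..s}. u i \<otimes>\<^bsub>V i\<^esub> act i (a i) \<mu> (v i),
      \<lambda>i\<in>{1..s}. (a i + \<gamma> i ^ nat \<mu> * a' i) mod int (l i)), (\<mu> + \<mu>') mod int p)"
  unfolding brace_B_def
  by (auto simp: asymmetric_product_def trivial_brace_def T_simps alpha_T_eq act_def mod_simps
      intro!: restrict_ext)

lemma add_B:
  "((u, a), \<mu>) \<oplus>\<^bsub>B\<^esub> ((v, a'), \<mu>') =
    ((\<lambda>i\<in>{1..s}. u i \<otimes>\<^bsub>V i\<^esub> v i, \<lambda>i\<in>{1..s}. (a i + a' i) mod int (l i)),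
      (\<mu> + \<mu>' + (\<Sum>i=1..s. bf i (u i) (v i))) mod int p)"
  unfolding brace_B_def
  by (auto simp: asymmetric_product_def trivial_brace_def T_simps form_T_def mod_simps)

lemma zero_B: "\<zero>\<^bsub>B\<^esub> = ((\<one>\<^bsub>VV\<^esub>, \<one>\<^bsub>AA\<^esub>), 0)"
  unfolding brace_B_def
  by (simp add: asymmetric_product_def trivial_brace_def T_simps)

text \<open>The components \<open>w\<close> and \<open>d\<close> are forced by the definition of the star product. The value of \<open>\<nu>\<close>
  cancels the two form terms that occur in the sum of \<open>((u, a), \<mu>)\<close>, \<open>((v, a'), \<mu>')\<close> and
  \<open>((w, d), \<nu>)\<close>.\<close>

lemma star_B:
  assumes x: "((u, a), \<mu>) \<in> carrier B" and y: "((v, a'), \<mu>') \<in> carrier B"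
    and w: "w = (\<lambda>i\<in>{1..s}. act i (a i) \<mu> (v i) \<otimes>\<^bsub>V i\<^esub> inv\<^bsub>V i\<^esub> v i)"
    and d: "d = (\<lambda>i\<in>{1..s}. (\<gamma> i ^ nat \<mu> * a' i - a' i) mod int (l i))"
    and \<nu>: "\<nu> = (- (\<Sum>i=1..s. bf i (u i) (v i)) - (\<Sum>i=1..s. bf i (u i \<otimes>\<^bsub>V i\<^esub> v i) (w i))) mod int p"
  shows "brace_star B ((u, a), \<mu>) ((v, a'), \<mu>') = ((w, d), \<nu>)" and "((w, d), \<nu>) \<in> carrier B"
proof -
  have u: "u \<in> carrier VV" and v: "v \<in> carrier VV" and \<mu>: "0 \<le> \<mu>"
    using x y by (auto simp: carrier_B simp del: carrier_product_group)
  have ui: "u i \<in> carrier (V i)" and vi: "v i \<in> carrier (V i)"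
    and ai: "act i (a i) \<mu> (v i) \<in> carrier (V i)" if "i \<in> {1..s}" for i
    using that VV_mem[OF u that] VV_mem[OF v that] act_closed by auto
  have inv: "inv\<^bsub>V i\<^esub> v i \<in> carrier (V i)" if "i \<in> {1..s}" for i
    using vi[OF that] comm_group_zp_space comm_group.axioms(2) group.inv_closed by metis
  have "w \<in> carrier VV"
    using inv ai comm_group_zp_space comm_groupE(1) by (fastforce simp: w restrict_PiE_iff)
  moreover have "d \<in> carrier AA"
    unfolding carrier_AA d using l_pos by (simp add: restrict_PiE_iff)
  ultimately show closed: "((w, d), \<nu>) \<in> carrier B"
    using p_gt_1 by (simp add: carrier_B \<nu> del: carrier_product_group)
  have V: "u i \<otimes>\<^bsub>V i\<^esub> act i (a i) \<mu> (v i) = (u i \<otimes>\<^bsub>V i\<^esub> v i) \<otimes>\<^bsub>V i\<^esub> w i" if i: "i \<in> {1..s}" for i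
  proof -
    interpret V: comm_group "V i" by (rule comm_group_zp_space)
    show ?thesis
      using ui[OF i] vi[OF i] ai[OF i] i
      by (simp add: w V.m_assoc V.m_comm[of "act i (a i) \<mu> (v i)"]) (simp flip: V.m_assoc)
  qed
  show "brace_star B ((u, a), \<mu>) ((v, a'), \<mu>') = ((w, d), \<nu>)"
  proof (rule B.brace_star_eqI[OF x y closed])
    have "(\<Sum>i=1..s. bf i ((\<lambda>i\<in>{1..s}. u i \<otimes>\<^bsub>V i\<^esub> v i) i) (w i)) = (\<Sum>i=1..s. bf i (u i \<otimes>\<^bsub>V i\<^esub> v i) (w i))"
      by (rule sum.cong) auto
    moreover have "(S mod int p + D mod int p + W) mod int p = (S + D + W) mod int p" for S D W :: int
      by (metis mod_add_eq mod_add_left_eq)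
    ultimately show "((u, a), \<mu>) \<otimes>\<^bsub>B\<^esub> ((v, a'), \<mu>')
        = ((u, a), \<mu>) \<oplus>\<^bsub>B\<^esub> ((v, a'), \<mu>') \<oplus>\<^bsub>B\<^esub> ((w, d), \<nu>)"
      using V by (auto simp: mult_B[OF \<mu>] add_B \<nu> d mod_simps intro!: restrict_ext)
  qed
qed


section \<open>Simplicity\<close>

lemma VV_one: "\<one>\<^bsub>VV\<^esub> \<in> carrier VV" and AA_one: "\<one>\<^bsub>AA\<^esub> \<in> carrier AA"
  using comm_groupE(2)[OF comm_group_VV] comm_groupE(2)[OF comm_group_AA] by blast+

lemma last_factor_mem_B: "\<lbrakk>0 \<le> \<mu>; \<mu> < int p\<rbrakk> \<Longrightarrow> ((\<one>\<^bsub>VV\<^esub>, \<one>\<^bsub>AA\<^esub>), \<mu>) \<in> carrier B"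
  using VV_one AA_one by (simp only: carrier_B)

lemma act_zero: "u \<in> carrier (V i) \<Longrightarrow> act i 0 0 u = u"
  by (simp add: act_def orthogonal_group_one_apply)

lemma act_fixes_zero: "i \<in> {1..s} \<Longrightarrow> act i a \<mu> \<one>\<^bsub>V i\<^esub> = \<one>\<^bsub>V i\<^esub>"
  using orthogonal_group_fixes_zero[OF c_pow_closed] orthogonal_group_fixes_zero[OF f_pow_closed]
  by (simp add: act_def)

definition single :: "nat \<Rightarrow> (nat \<Rightarrow> int) \<Rightarrow> nat \<Rightarrow> nat \<Rightarrow> int" where
  "single i w = (\<lambda>j\<in>{1..s}. if j = i then w else \<one>\<^bsub>V j\<^esub>)"

lemma single_closed:
  assumes "w \<in> carrier (V i)"
  shows "single i w \<in> carrier VV"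
proof -
  have "\<one>\<^bsub>V j\<^esub> \<in> carrier (V j)" for j
    using comm_groupE(2)[OF comm_group_zp_space] .
  then show ?thesis
    using assms by (simp add: single_def restrict_PiE_iff)
qed

lemma V_diff_self: "v \<in> carrier (V i) \<Longrightarrow> v \<otimes>\<^bsub>V i\<^esub> inv\<^bsub>V i\<^esub> v = \<one>\<^bsub>V i\<^esub>"
  using comm_group_zp_space comm_group.axioms(2) group.r_inv by metis

text \<open>Acting by a vector \<open>w\<close> is a transvection along the last factor: the two other components of the
  star product vanish, and only the value of the form survives.\<close>

lemma star_translation:
  assumes w: "w \<in> carrier VV" and x: "((u, a), \<mu>) \<in> carrier B"
  shows "brace_star B ((w, \<one>\<^bsub>AA\<^esub>), 0) ((u, a), \<mu>)
    = ((\<one>\<^bsub>VV\<^esub>, \<one>\<^bsub>AA\<^esub>), (- (\<Sum>i=1..s. bf i (w i) (u i))) mod int p)"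
proof -
  have w': "((w, \<one>\<^bsub>AA\<^esub>), 0) \<in> carrier B"
    using w AA_one p_gt_1 by (simp only: carrier_B) simp
  have u: "u \<in> carrier VV"
    using x by (simp only: carrier_B)
  have 1: "\<one>\<^bsub>VV\<^esub> = (\<lambda>i\<in>{1..s}. act i (\<one>\<^bsub>AA\<^esub> i) 0 (u i) \<otimes>\<^bsub>V i\<^esub> inv\<^bsub>V i\<^esub> u i)"
    using VV_mem[OF u] by (auto simp: act_zero V_diff_self intro!: restrict_ext)
  have 2: "\<one>\<^bsub>AA\<^esub> = (\<lambda>i\<in>{1..s}. (\<gamma> i ^ nat 0 * a i - a i) mod int (l i))"
    by (auto intro!: restrict_ext)
  have "bf i (w i \<otimes>\<^bsub>V i\<^esub> u i) (\<one>\<^bsub>VV\<^esub> i) = 0" if i: "i \<in> {1..s}" for i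
    using metacyclic_isometries.form_zero_right[OF factor[OF i]] i VV_mem[OF u i] VV_mem[OF w i]
      comm_groupE(1)[OF comm_group_zp_space] by simp
  then have 3: "(- (\<Sum>i=1..s. bf i (w i) (u i))) mod int p
    = (- (\<Sum>i=1..s. bf i (w i) (u i)) - (\<Sum>i=1..s. bf i (w i \<otimes>\<^bsub>V i\<^esub> u i) (\<one>\<^bsub>VV\<^esub> i))) mod int p"
    by simp
  show ?thesis
    by (rule star_B(1)[OF w' x 1 2 3])
qed

lemma ideal_subgroup: "brace_ideal N B \<Longrightarrow> subgroup N B"
  by (simp add: brace_ideal_def normal_def)

text \<open>Non-degeneracy supplies a vector \<open>w\<close> in one \<open>V i\<close> with \<open>b\<^sub>i(w, u\<^sub>i) \<noteq> 0\<close>; extended by zero, its star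
  product with the given element is a non-zero element of the last factor.\<close>

lemma ideal_meets_last_factor_if_vector_nonzero:
  assumes N: "brace_ideal N B" and x: "((u, a), \<mu>) \<in> N" and "u \<noteq> \<one>\<^bsub>VV\<^esub>"
  obtains \<nu> where "((\<one>\<^bsub>VV\<^esub>, \<one>\<^bsub>AA\<^esub>), \<nu>) \<in> N" "0 < \<nu>" "\<nu> < int p"
proof -
  have xB: "((u, a), \<mu>) \<in> carrier B"
    using x subgroup.mem_carrier[OF ideal_subgroup[OF N]] by blast
  then have u: "u \<in> carrier VV" by (simp only: carrier_B)
  obtain i where i: "i \<in> {1..s}" "u i \<noteq> \<one>\<^bsub>V i\<^esub>"
    using PiE_neqE[OF u[unfolded carrier_product_group] VV_one[unfolded carrier_product_group]
        \<open>u \<noteq> \<one>\<^bsub>VV\<^esub>\<close>] by auto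
  obtain w where w: "w \<in> carrier (V i)" "bf i w (u i) \<noteq> 0"
    using metacyclic_isometries.exists_nonorthogonal[OF factor[OF i(1)] VV_mem[OF u i(1)] i(2)] .
  define \<nu> where "\<nu> = (- bf i w (u i)) mod int p"
  have other: "bf j (single i w j) (u j) = (if j = i then bf i w (u i) else 0)" if j: "j \<in> {1..s}" for j
  proof (cases "j = i")
    case False
    have "bf j \<one>\<^bsub>V j\<^esub> (u j) = bf j (u j) \<one>\<^bsub>V j\<^esub>"
      using metacyclic_isometries.form_sym[OF factor[OF j]] VV_mem[OF u j]
        comm_groupE(2)[OF comm_group_zp_space] by blast
    then show ?thesis
      using False j metacyclic_isometries.form_zero_right[OF factor[OF j] VV_mem[OF u j]]
      by (simp add: single_def)
  qed (use i in \<open>simp add: single_def\<close>)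
  have sum: "(\<Sum>j=1..s. bf j (single i w j) (u j)) = bf i w (u i)"
    using i(1) by (simp only: other sum.delta finite_atLeastAtMost cong: sum.cong) simp
  have "0 < bf i w (u i)" "bf i w (u i) < int p"
    using metacyclic_isometries.form_range[OF factor[OF i(1)] w(1) VV_mem[OF u i(1)]] w(2) by auto
  then have "0 < \<nu>" "\<nu> < int p"
    by (auto simp: \<nu>_def zmod_zminus1_eq_if)
  moreover have "((single i w, \<one>\<^bsub>AA\<^esub>), 0) \<in> carrier B"
    using single_closed[OF w(1)] AA_one p_gt_1 by (simp only: carrier_B) simp
  then have "brace_star B ((single i w, \<one>\<^bsub>AA\<^esub>), 0) ((u, a), \<mu>) \<in> N"
    using B.ideal_star_closed[OF N _ xB] x by blast
  then have "((\<one>\<^bsub>VV\<^esub>, \<one>\<^bsub>AA\<^esub>), \<nu>) \<in> N"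
    unfolding star_translation[OF single_closed[OF w(1)] xB] sum \<nu>_def .
  ultimately show thesis using that by blast
qed

text \<open>The remaining case is an element with \<open>u = 0\<close> and \<open>a\<^sub>i \<noteq> 0\<close>: by faithfulness \<open>c\<^sub>i\<^sup>a f\<^sub>i\<^sup>\<mu>\<close> moves
  some \<open>v\<close>, and the star product with \<open>v\<close> is an element of \<open>N\<close> with non-zero first component.\<close>

lemma ideal_meets_last_factor:
  assumes N: "brace_ideal N B" and "N \<noteq> {\<zero>\<^bsub>B\<^esub>}"
  obtains \<nu> where "((\<one>\<^bsub>VV\<^esub>, \<one>\<^bsub>AA\<^esub>), \<nu>) \<in> N" "0 < \<nu>" "\<nu> < int p"
proof -
  have "\<zero>\<^bsub>B\<^esub> \<in> N"
    using subgroup.one_closed[OF ideal_subgroup[OF N]] by (simp add: B.zero_eq_one)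
  then obtain x where x: "x \<in> N" "x \<noteq> \<zero>\<^bsub>B\<^esub>"
    using \<open>N \<noteq> {\<zero>\<^bsub>B\<^esub>}\<close> by blast
  have xB: "x \<in> carrier B"
    using x subgroup.mem_carrier[OF ideal_subgroup[OF N]] by blast
  then obtain u a \<mu> where xe: "x = ((u, a), \<mu>)"
    and c: "u \<in> carrier VV" "a \<in> carrier AA" "0 \<le> \<mu>" "\<mu> < int p"
    by (rule B_cases)
  consider "u \<noteq> \<one>\<^bsub>VV\<^esub>" | "u = \<one>\<^bsub>VV\<^esub>" "a = \<one>\<^bsub>AA\<^esub>" | "a \<noteq> \<one>\<^bsub>AA\<^esub>" by blast
  then show thesis
  proof cases
    case 1
    then show thesis
      using ideal_meets_last_factor_if_vector_nonzero[OF N x(1)[unfolded xe]] that by blast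
  next
    case 2
    then have "\<mu> \<noteq> 0" using x(2) by (auto simp: xe zero_B)
    then show thesis
      using that[of \<mu>] x(1) c 2 by (simp add: xe)
  next
    case 3
    then obtain i where i: "i \<in> {1..s}" "a i \<noteq> 0"
      using PiE_neqE[OF c(2)[unfolded carrier_product_group] AA_one[unfolded carrier_product_group] 3]
      by auto
    have ai: "0 \<le> a i" "a i < int (l i)"
      using AA_mem[OF c(2) i(1)] by auto
    let ?g = "c i [^]\<^bsub>OG i\<^esub> a i \<otimes>\<^bsub>OG i\<^esub> f i [^]\<^bsub>OG i\<^esub> \<mu>"
    interpret O: group "OG i" by (rule group_orthogonal_group)
    have "?g \<noteq> \<one>\<^bsub>OG i\<^esub>"
      using metacyclic_isometries.act_faithful[OF factor[OF i(1)] ai c(3,4)] i(2) by blast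
    moreover have "?g \<in> carrier (OG i)"
      using c_pow_closed[OF i(1)] f_pow_closed[OF i(1)] by blast
    ultimately obtain v where v: "v \<in> carrier (V i)" "?g v \<noteq> \<one>\<^bsub>OG i\<^esub> v"
      using orthogonal_group_eqI O.one_closed by metis
    then have moved: "act i (a i) \<mu> v \<noteq> v"
      using i(1)
      by (simp add: act_def orthogonal_group_mult_apply orthogonal_group_one_apply c_pow_closed f_pow_closed)
    have y: "((single i v, \<one>\<^bsub>AA\<^esub>), 0) \<in> carrier B"
      using single_closed[OF v(1)] AA_one p_gt_1 by (simp only: carrier_B) simp
    define w where "w = (\<lambda>j\<in>{1..s}. act j (a j) \<mu> (single i v j) \<otimes>\<^bsub>V j\<^esub> inv\<^bsub>V j\<^esub> single i v j)"
    interpret V: comm_group "V i" by (rule comm_group_zp_space)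
    have "w i = act i (a i) \<mu> v \<otimes>\<^bsub>V i\<^esub> inv\<^bsub>V i\<^esub> v"
      using i(1) by (simp add: w_def single_def)
    then have "w i \<noteq> \<one>\<^bsub>V i\<^esub>"
      using moved act_closed[OF i(1) v(1), of "a i" \<mu>] v(1)
      by (metis V.inv_closed V.inv_equality V.inv_inv)
    then have "w \<noteq> \<one>\<^bsub>VV\<^esub>"
      using i(1) by auto
    moreover obtain d \<nu> where "brace_star B x ((single i v, \<one>\<^bsub>AA\<^esub>), 0) = ((w, d), \<nu>)"
      using star_B(1)[OF xB[unfolded xe] y w_def refl refl] xe by blast
    then have "((w, d), \<nu>) \<in> N"
      using B.ideal_star_closed[OF N xB y] x(1) by metis
    ultimately show thesis
      using ideal_meets_last_factor_if_vector_nonzero[OF N] that by blast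
  qed
qed

lemma last_factor_mult:
  assumes "((u, a), \<mu>) \<in> carrier B"
  shows "((u, a), \<mu>) \<otimes>\<^bsub>B\<^esub> ((\<one>\<^bsub>VV\<^esub>, \<one>\<^bsub>AA\<^esub>), \<nu>) = ((u, a), (\<mu> + \<nu>) mod int p)"
proof -
  have c: "u \<in> carrier VV" "a \<in> carrier AA" "0 \<le> \<mu>"
    using assms by (simp_all only: carrier_B)
  have "(\<lambda>i\<in>{1..s}. u i \<otimes>\<^bsub>V i\<^esub> act i (a i) \<mu> (\<one>\<^bsub>VV\<^esub> i)) = u"
    using c(1) VV_mem[OF c(1)] monoid.r_one[OF group.is_monoid[OF comm_group.axioms(2)[OF comm_group_zp_space]]]
    by (intro PiE_ext[of _ "{1..s}" "\<lambda>i. carrier (V i)" u])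
      (auto simp: restrict_PiE_iff act_fixes_zero)
  moreover have "(\<lambda>i\<in>{1..s}. (a i + \<gamma> i ^ nat \<mu> * \<one>\<^bsub>AA\<^esub> i) mod int (l i)) = a"
    using c(2) AA_mem[OF c(2)] unfolding carrier_AA
    by (intro PiE_ext[of _ "{1..s}" "\<lambda>i. {0..<int (l i)}" a]) (auto simp: restrict_PiE_iff)
  ultimately show ?thesis
    by (simp only: mult_B[OF c(3)])
qed

text \<open>The last factor has prime order, so any of its non-zero elements generates it.\<close>

lemma last_factor_subset_ideal:
  assumes N: "brace_ideal N B" and \<nu>: "((\<one>\<^bsub>VV\<^esub>, \<one>\<^bsub>AA\<^esub>), \<nu>) \<in> N" "0 < \<nu>" "\<nu> < int p"
    and \<mu>: "0 \<le> \<mu>" "\<mu> < int p"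
  shows "((\<one>\<^bsub>VV\<^esub>, \<one>\<^bsub>AA\<^esub>), \<mu>) \<in> N"
proof -
  have N': "subgroup N B" using N by (rule ideal_subgroup)
  have multiples: "((\<one>\<^bsub>VV\<^esub>, \<one>\<^bsub>AA\<^esub>), int k * \<nu> mod int p) \<in> N" for k
  proof (induction k)
    case 0
    have "\<zero>\<^bsub>B\<^esub> \<in> N"
      using subgroup.one_closed[OF N'] by (simp add: B.zero_eq_one)
    then show ?case
      by (simp only: zero_B of_nat_0 mult_zero_left mod_0)
  next
    case (Suc k)
    have "((\<one>\<^bsub>VV\<^esub>, \<one>\<^bsub>AA\<^esub>), int k * \<nu> mod int p) \<otimes>\<^bsub>B\<^esub> ((\<one>\<^bsub>VV\<^esub>, \<one>\<^bsub>AA\<^esub>), \<nu>)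
        = ((\<one>\<^bsub>VV\<^esub>, \<one>\<^bsub>AA\<^esub>), (int k * \<nu> mod int p + \<nu>) mod int p)"
      using p_gt_1 by (intro last_factor_mult last_factor_mem_B) auto
    also have "(int k * \<nu> mod int p + \<nu>) mod int p = int (Suc k) * \<nu> mod int p"
      by (simp add: mod_simps algebra_simps)
    finally show ?case
      using subgroup.m_closed[OF N' Suc.IH \<nu>(1)] by (simp only:)
  qed
  have "\<not> int p dvd \<nu>"
    using \<nu> zdvd_not_zless by blast
  then have "coprime \<nu> (int p)"
    using prime_imp_coprime[of "int p" \<nu>] prime by (simp add: coprime_commute)
  \<comment> \<open>The multiple of \<open>\<nu>\<close> that equals \<open>\<mu>\<close> is found with an inverse \<open>y\<close> of \<open>\<nu>\<close> modulo \<open>p\<close>.\<close>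
  then obtain y where y: "[\<nu> * y = 1] (mod int p)"
    using cong_solve_coprime_int by blast
  define k where "k = nat (y * \<mu> mod int p)"
  have "int k * \<nu> mod int p = (y * \<mu> mod int p) * \<nu> mod int p"
    using p_gt_1 by (simp add: k_def)
  also have "\<dots> = (\<nu> * y) * \<mu> mod int p"
    by (simp add: mod_simps mult_ac)
  also have "\<dots> = 1 * \<mu> mod int p"
    using y unfolding cong_def by (metis mod_mult_left_eq)
  also have "\<dots> = \<mu>" using \<mu> by simp
  finally show ?thesis using multiples[of k] by simp
qed

text \<open>Once an ideal contains the last factor, the last coordinate of its elements is arbitrary. This
  is why the value of \<open>\<nu>\<close> in \<open>star_B\<close> can be ignored in the following proof.\<close>

lemma ideal_change_last_factor:
  assumes N: "brace_ideal N B" and last_factor: "\<And>\<nu>. \<lbrakk>0 \<le> \<nu>; \<nu> < int p\<rbrakk> \<Longrightarrow> ((\<one>\<^bsub>VV\<^esub>, \<one>\<^bsub>AA\<^esub>), \<nu>) \<in> N"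
    and x: "((u, a), \<mu>) \<in> N" and \<mu>': "0 \<le> \<mu>'" "\<mu>' < int p"
  shows "((u, a), \<mu>') \<in> N"
proof -
  have N': "subgroup N B" using N by (rule ideal_subgroup)
  have "((\<one>\<^bsub>VV\<^esub>, \<one>\<^bsub>AA\<^esub>), (\<mu>' - \<mu>) mod int p) \<in> N"
    using p_gt_1 by (intro last_factor) auto
  then have "((u, a), \<mu>) \<otimes>\<^bsub>B\<^esub> ((\<one>\<^bsub>VV\<^esub>, \<one>\<^bsub>AA\<^esub>), (\<mu>' - \<mu>) mod int p) \<in> N"
    by (rule subgroup.m_closed[OF N' x])
  moreover have "((u, a), \<mu>) \<otimes>\<^bsub>B\<^esub> ((\<one>\<^bsub>VV\<^esub>, \<one>\<^bsub>AA\<^esub>), (\<mu>' - \<mu>) mod int p)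
      = ((u, a), (\<mu> + (\<mu>' - \<mu>) mod int p) mod int p)"
    using subgroup.mem_carrier[OF N' x] by (rule last_factor_mult)
  moreover have "(\<mu> + (\<mu>' - \<mu>) mod int p) mod int p = \<mu>'"
    using \<mu>' by (simp add: mod_simps)
  ultimately show ?thesis by metis
qed

text \<open>With \<open>z = ((0, 0), 1)\<close> and \<open>e = ((0, (1, \<dots>, 1)), 0)\<close>, the elements \<open>z * ((0, a'), 0)\<close> exhaust \<open>A\<close>
  because every \<open>\<gamma>\<^sub>i - 1\<close> is invertible; in particular \<open>e \<in> N\<close>. The star products of \<open>e\<close> and \<open>z\<close> with
  vectors are the displacements under \<open>c\<close> and \<open>f\<close>, and their sums exhaust the vectors by hypothesis.\<close>

lemma ideal_eq_carrier:
  assumes N: "brace_ideal N B" and "N \<noteq> {\<zero>\<^bsub>B\<^esub>}"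
    and full: "\<And>i. i \<in> {1..s} \<Longrightarrow> displacement p (n i) (c i) (f i) = carrier (V i)"
  shows "N = carrier B"
proof
  show "N \<subseteq> carrier B"
    using subgroup.subset[OF ideal_subgroup[OF N]] .
  obtain \<nu> where "((\<one>\<^bsub>VV\<^esub>, \<one>\<^bsub>AA\<^esub>), \<nu>) \<in> N" "0 < \<nu>" "\<nu> < int p"
    using ideal_meets_last_factor[OF N \<open>N \<noteq> {\<zero>\<^bsub>B\<^esub>}\<close>] .
  then have last_factor: "((\<one>\<^bsub>VV\<^esub>, \<one>\<^bsub>AA\<^esub>), \<mu>) \<in> N" if "0 \<le> \<mu>" "\<mu> < int p" for \<mu>
    using last_factor_subset_ideal[OF N] that by blast
  note change = ideal_change_last_factor[OF N last_factor]
  have rot: "((\<one>\<^bsub>VV\<^esub>, \<one>\<^bsub>AA\<^esub>), 1) \<in> carrier B" "((\<one>\<^bsub>VV\<^esub>, \<one>\<^bsub>AA\<^esub>), 1) \<in> N"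
    using last_factor_mem_B[of 1] last_factor[of 1] p_gt_1 by auto
  have A: "((\<one>\<^bsub>VV\<^esub>, a), \<mu>) \<in> N" if a: "a \<in> carrier AA" and \<mu>: "0 \<le> \<mu>" "\<mu> < int p" for a \<mu>
  proof -
    have "\<exists>x. 0 \<le> x \<and> x < int (l i) \<and> (\<gamma> i * x - x) mod int (l i) = a i" if i: "i \<in> {1..s}" for i
      using metacyclic_isometries.\<gamma>_minus_one_solvable[OF factor[OF i], of "a i"] AA_mem[OF a i]
      by (metis mod_pos_pos_trivial)
    then obtain a0 where a0:
      "\<And>i. i \<in> {1..s} \<Longrightarrow> 0 \<le> a0 i \<and> a0 i < int (l i) \<and> (\<gamma> i * a0 i - a0 i) mod int (l i) = a i"
      by metis
    define a' where "a' = restrict a0 {1..s}"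
    have "a' \<in> carrier AA"
      unfolding carrier_AA a'_def using a0 by (simp add: restrict_PiE_iff)
    then have y: "((\<one>\<^bsub>VV\<^esub>, a'), 0) \<in> carrier B"
      using VV_one p_gt_1 by (simp only: carrier_B) simp
    have 1: "\<one>\<^bsub>VV\<^esub> = (\<lambda>i\<in>{1..s}. act i (\<one>\<^bsub>AA\<^esub> i) 1 (\<one>\<^bsub>VV\<^esub> i) \<otimes>\<^bsub>V i\<^esub> inv\<^bsub>V i\<^esub> \<one>\<^bsub>VV\<^esub> i)"
      using comm_groupE(2)[OF comm_group_zp_space]
      by (auto simp: act_fixes_zero V_diff_self intro!: restrict_ext)
    have 2: "a = (\<lambda>i\<in>{1..s}. (\<gamma> i ^ nat 1 * a' i - a' i) mod int (l i))"
      using a a0 by (intro PiE_ext[of a "{1..s}" "\<lambda>i. {0..<int (l i)}"])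
        (auto simp: carrier_AA a'_def restrict_PiE_iff l_pos simp del: carrier_product_group One_nat_def)
    obtain \<nu>' where "brace_star B ((\<one>\<^bsub>VV\<^esub>, \<one>\<^bsub>AA\<^esub>), 1) ((\<one>\<^bsub>VV\<^esub>, a'), 0) = ((\<one>\<^bsub>VV\<^esub>, a), \<nu>')"
      using star_B(1)[OF rot(1) y 1 2 refl] by blast
    then have "((\<one>\<^bsub>VV\<^esub>, a), \<nu>') \<in> N"
      using B.ideal_star_closed[OF N rot(1) y] rot(2) by metis
    then show ?thesis using change \<mu> by blast
  qed
  define e where "e = (\<lambda>i\<in>{1..s}. 1 :: int)"
  have e: "e \<in> carrier AA"
    unfolding carrier_AA e_def using l_gt_1 by (simp add: restrict_PiE_iff)
  then have eB: "((\<one>\<^bsub>VV\<^esub>, e), 0) \<in> carrier B" "((\<one>\<^bsub>VV\<^esub>, e), 0) \<in> N"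
    using VV_one p_gt_1 A[of e 0] by (simp_all only: carrier_B) auto
  have star_V: "\<exists>\<nu>. ((\<lambda>i\<in>{1..s}. act i (a i) \<mu> (v i) \<otimes>\<^bsub>V i\<^esub> inv\<^bsub>V i\<^esub> v i, \<one>\<^bsub>AA\<^esub>), \<nu>) \<in> N"
    if v: "v \<in> carrier VV" and g: "((\<one>\<^bsub>VV\<^esub>, a), \<mu>) \<in> carrier B" "((\<one>\<^bsub>VV\<^esub>, a), \<mu>) \<in> N" for a \<mu> v
  proof -
    have y: "((v, \<one>\<^bsub>AA\<^esub>), 0) \<in> carrier B"
      using v AA_one p_gt_1 by (simp only: carrier_B) simp
    have 2: "\<one>\<^bsub>AA\<^esub> = (\<lambda>i\<in>{1..s}. (\<gamma> i ^ nat \<mu> * \<one>\<^bsub>AA\<^esub> i - \<one>\<^bsub>AA\<^esub> i) mod int (l i))"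
      by (auto intro!: restrict_ext)
    show ?thesis
      using B.ideal_star_closed[OF N g(1) y] g(2) unfolding star_B(1)[OF g(1) y refl 2 refl] by blast
  qed
  have V: "((u, \<one>\<^bsub>AA\<^esub>), \<mu>) \<in> N" if u: "u \<in> carrier VV" and \<mu>: "0 \<le> \<mu>" "\<mu> < int p" for u \<mu>
  proof -
    have "\<exists>x y. x \<in> carrier (V i) \<and> y \<in> carrier (V i) \<and>
        u i = (c i x \<otimes>\<^bsub>V i\<^esub> inv\<^bsub>V i\<^esub> x) \<otimes>\<^bsub>V i\<^esub> (f i y \<otimes>\<^bsub>V i\<^esub> inv\<^bsub>V i\<^esub> y)" if i: "i \<in> {1..s}" for i
      using metacyclic_isometries.displacement_cases[OF factor[OF i], of "u i"] full[OF i] VV_mem[OF u i]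
      by metis
    then obtain x0 y0 where xy: "\<And>i. i \<in> {1..s} \<Longrightarrow> x0 i \<in> carrier (V i) \<and> y0 i \<in> carrier (V i) \<and>
        u i = (c i (x0 i) \<otimes>\<^bsub>V i\<^esub> inv\<^bsub>V i\<^esub> (x0 i)) \<otimes>\<^bsub>V i\<^esub> (f i (y0 i) \<otimes>\<^bsub>V i\<^esub> inv\<^bsub>V i\<^esub> (y0 i))"
      by metis
    define x y where "x = restrict x0 {1..s}" and "y = restrict y0 {1..s}"
    have xV: "x \<in> carrier VV" and yV: "y \<in> carrier VV"
      using xy by (auto simp: x_def y_def)
    define w w' where "w = (\<lambda>i\<in>{1..s}. act i (e i) 0 (x i) \<otimes>\<^bsub>V i\<^esub> inv\<^bsub>V i\<^esub> x i)"
      and "w' = (\<lambda>i\<in>{1..s}. act i (\<one>\<^bsub>AA\<^esub> i) 1 (y i) \<otimes>\<^bsub>V i\<^esub> inv\<^bsub>V i\<^esub> y i)"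
    obtain \<nu>1 \<nu>2 where "((w, \<one>\<^bsub>AA\<^esub>), \<nu>1) \<in> N" "((w', \<one>\<^bsub>AA\<^esub>), \<nu>2) \<in> N"
      using star_V[OF xV eB] star_V[OF yV rot] unfolding w_def w'_def by blast
    then have sum: "((w, \<one>\<^bsub>AA\<^esub>), \<nu>1) \<oplus>\<^bsub>B\<^esub> ((w', \<one>\<^bsub>AA\<^esub>), \<nu>2) \<in> N"
      by (rule B.ideal_add_closed[OF N])
    have "(\<lambda>i\<in>{1..s}. w i \<otimes>\<^bsub>V i\<^esub> w' i) i = u i" if i: "i \<in> {1..s}" for i
    proof -
      interpret O: group "OG i" by (rule group_orthogonal_group)
      have "act i 1 0 (x i) = c i (x i)" "act i 0 1 (y i) = f i (y i)"
        using metacyclic_isometries.c_closed[OF factor[OF i]] metacyclic_isometries.f_closed[OF factor[OF i]]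
          VV_mem[OF xV i] VV_mem[OF yV i]
        by (simp_all add: act_def orthogonal_group_one_apply orthogonal_group_props(3))
      then show ?thesis
        using i xy[OF i] by (simp add: w_def w'_def e_def x_def y_def)
    qed
    then have "(\<lambda>i\<in>{1..s}. w i \<otimes>\<^bsub>V i\<^esub> w' i) = u"
      using u by (intro extensionalityI[of _ "{1..s}" u]) (simp_all add: PiE_iff)
    moreover have "(\<lambda>i\<in>{1..s}. (\<one>\<^bsub>AA\<^esub> i + \<one>\<^bsub>AA\<^esub> i) mod int (l i)) = \<one>\<^bsub>AA\<^esub>"
      by (auto intro!: restrict_ext)
    ultimately obtain \<nu>3 where "((u, \<one>\<^bsub>AA\<^esub>), \<nu>3) \<in> N"
      using sum by (simp only: add_B)
    then show ?thesis using change \<mu> by blast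
  qed
  show "carrier B \<subseteq> N"
  proof
    fix x assume "x \<in> carrier B"
    then obtain u a \<mu> where x: "x = ((u, a), \<mu>)"
      and c: "u \<in> carrier VV" "a \<in> carrier AA" "0 \<le> \<mu>" "\<mu> < int p"
      by (rule B_cases)
    have "((u, \<one>\<^bsub>AA\<^esub>), 0) \<oplus>\<^bsub>B\<^esub> ((\<one>\<^bsub>VV\<^esub>, a), 0) \<in> N"
      using V[OF c(1), of 0] A[OF c(2), of 0] p_gt_1 by (intro B.ideal_add_closed[OF N]) auto
    moreover have "(\<lambda>i\<in>{1..s}. u i \<otimes>\<^bsub>V i\<^esub> \<one>\<^bsub>VV\<^esub> i) = u"
      using comm_groupE(5)[OF comm_group_VV c(1)] comm_groupE(4)[OF comm_group_VV c(1) VV_one]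
      by (simp only: mult_product_group)
    moreover have "(\<lambda>i\<in>{1..s}. (\<one>\<^bsub>AA\<^esub> i + a i) mod int (l i)) = a"
      using comm_groupE(5)[OF comm_group_AA c(2)] by simp
    ultimately obtain \<nu> where "((u, a), \<nu>) \<in> N"
      by (simp only: add_B)
    then show "x \<in> N"
      unfolding x using change c by blast
  qed
qed

text \<open>Normality comes from the homomorphism \<open>((u, a), \<mu>) \<mapsto> u\<^sub>i + W\<^sub>i\<close>; closure under \<open>\<lambda>\<close> from
  \<open>\<lambda>\<^sub>x(y) = y + x * y\<close>, where the \<open>i\<close>-th vector of \<open>x * y\<close> is a displacement.\<close>

lemma displacement_ideal:
  assumes i: "i \<in> {1..s}"
  shows "brace_ideal {x \<in> carrier B. fst (fst x) i \<in> displacement p (n i) (c i) (f i)} B"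
    (is "brace_ideal ?N B")
proof -
  let ?W = "displacement p (n i) (c i) (f i)"
  let ?\<phi> = "\<lambda>x. ?W #>\<^bsub>V i\<^esub> fst (fst x) i"
  interpret V: comm_group "V i" by (rule comm_group_zp_space)
  have W: "subgroup ?W (V i)"
    using metacyclic_isometries.subgroup_displacement[OF factor[OF i]] .
  then interpret W: normal ?W "V i"
    by (rule V.subgroup_imp_normal)
  have move: "act i a \<mu> v \<otimes>\<^bsub>V i\<^esub> inv\<^bsub>V i\<^esub> v \<in> ?W" if "0 \<le> a" "0 \<le> \<mu>" "v \<in> carrier (V i)" for a \<mu> v
    unfolding act_def using metacyclic_isometries.displacement_act[OF factor[OF i]] that by blast
  have proj: "fst (fst x) i \<in> carrier (V i)" if "x \<in> carrier B" for x
    using that VV_mem[OF _ i] by (auto elim!: B_cases simp del: carrier_product_group)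
  have "?\<phi> \<in> hom B (V i Mod ?W)"
  proof (rule homI)
    fix x assume "x \<in> carrier B"
    then show "?\<phi> x \<in> carrier (V i Mod ?W)"
      using proj[of x] by (auto simp: FactGroup_def RCOSETS_def)
  next
    fix x y assume "x \<in> carrier B" "y \<in> carrier B"
    then obtain u a \<mu> v a' \<mu>' where
      e: "x = ((u, a), \<mu>)" "y = ((v, a'), \<mu>')" and
      c: "u \<in> carrier VV" "a \<in> carrier AA" "0 \<le> \<mu>" "v \<in> carrier VV"
      by (metis B_cases)
    have ui: "u i \<in> carrier (V i)" and vi: "v i \<in> carrier (V i)" and ai: "0 \<le> a i"
      using VV_mem[OF c(1) i] VV_mem[OF c(4) i] AA_mem[OF c(2) i] by auto
    have ga: "act i (a i) \<mu> (v i) \<in> carrier (V i)"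
      using act_closed[OF i vi] .
    have "?W #>\<^bsub>V i\<^esub> act i (a i) \<mu> (v i) = ?W #>\<^bsub>V i\<^esub> v i"
      using V.coset_join2[OF _ W move[OF ai c(3) vi]] ga vi
      by (intro V.coset_mult_inv1 W.subset) auto
    then have "?W #>\<^bsub>V i\<^esub> (u i \<otimes>\<^bsub>V i\<^esub> act i (a i) \<mu> (v i))
        = (?W #>\<^bsub>V i\<^esub> u i) <#>\<^bsub>V i\<^esub> (?W #>\<^bsub>V i\<^esub> v i)"
      using W.rcos_sum[OF ui ga] by simp
    then show "?\<phi> (x \<otimes>\<^bsub>B\<^esub> y) = ?\<phi> x \<otimes>\<^bsub>V i Mod ?W\<^esub> ?\<phi> y"
      using i by (simp add: e mult_B[OF c(3)] FactGroup_def)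
  qed
  then have \<phi>: "group_hom B (V i Mod ?W) ?\<phi>"
    by (rule group_hom.intro[OF B.is_group W.factorgroup_is_group group_hom_axioms.intro])
  have "?W #>\<^bsub>V i\<^esub> u = ?W \<longleftrightarrow> u \<in> ?W" if "u \<in> carrier (V i)" for u
    using V.coset_join1[OF _ that W] V.coset_join2[OF that W] by blast
  then have "?W #>\<^bsub>V i\<^esub> fst (fst x) i = ?W \<longleftrightarrow> fst (fst x) i \<in> ?W" if "x \<in> carrier B" for x
    using proj[OF that] by blast
  then have "?N = kernel B (V i Mod ?W) ?\<phi>"
    by (auto simp: kernel_def FactGroup_def)
  then have "?N \<lhd> B"
    using group_hom.normal_kernel[OF \<phi>] by (simp only:)
  moreover have "lambda_map B x y \<in> ?N" if x: "x \<in> carrier B" and y: "y \<in> ?N" for x y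
  proof -
    obtain u a \<mu> where xe: "x = ((u, a), \<mu>)" and xc: "a \<in> carrier AA" "0 \<le> \<mu>"
      using x by (rule B_cases)
    obtain v a' \<mu>' where ye: "y = ((v, a'), \<mu>')" and v: "v \<in> carrier VV" "v i \<in> ?W"
      using y by (auto elim!: B_cases)
    have yB: "y \<in> carrier B" using y by blast
    define w where "w = (\<lambda>i\<in>{1..s}. act i (a i) \<mu> (v i) \<otimes>\<^bsub>V i\<^esub> inv\<^bsub>V i\<^esub> v i)"
    obtain d \<nu> where star: "brace_star B x y = ((w, d), \<nu>)"
      using star_B(1)[OF x[unfolded xe] yB[unfolded ye] w_def refl refl] xe ye by blast
    have "w i \<in> ?W"
      using i move[of "a i" \<mu> "v i"] AA_mem[OF xc(1) i] xc(2) VV_mem[OF v(1) i] by (simp add: w_def)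
    then have "v i \<otimes>\<^bsub>V i\<^esub> w i \<in> ?W"
      using v(2) by (rule W.m_closed[rotated])
    then show ?thesis
      using i B.lambda_closed[OF x yB] by (simp add: B.lambda_eq_add_star[OF x yB] star) (simp add: ye add_B)
  qed
  ultimately show ?thesis
    by (auto simp: brace_ideal_def)
qed

theorem simple_iff:
  "simple_left_brace B \<longleftrightarrow> (\<forall>i\<in>{1..s}. displacement p (n i) (c i) (f i) = carrier (V i))"
proof
  assume full: "\<forall>i\<in>{1..s}. displacement p (n i) (c i) (f i) = carrier (V i)"
  have "((\<one>\<^bsub>VV\<^esub>, \<one>\<^bsub>AA\<^esub>), 1) \<in> carrier B"
    using last_factor_mem_B[of 1] p_gt_1 by simp
  then have "carrier B \<noteq> {\<zero>\<^bsub>B\<^esub>}"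
    by (auto simp: zero_B)
  then show "simple_left_brace B"
    using full ideal_eq_carrier left_brace_B by (auto simp: simple_left_brace_def)
next
  assume simple: "simple_left_brace B"
  show "\<forall>i\<in>{1..s}. displacement p (n i) (c i) (f i) = carrier (V i)"
  proof
    fix i assume i: "i \<in> {1..s}"
    let ?W = "displacement p (n i) (c i) (f i)"
    let ?N = "{x \<in> carrier B. fst (fst x) i \<in> ?W}"
    have W: "subgroup ?W (V i)"
      using metacyclic_isometries.subgroup_displacement[OF factor[OF i]] .
    have "((\<one>\<^bsub>VV\<^esub>, \<one>\<^bsub>AA\<^esub>), 1) \<in> ?N"
      using last_factor_mem_B[of 1] p_gt_1 i subgroup.one_closed[OF W] by simp
    moreover have "((\<one>\<^bsub>VV\<^esub>, \<one>\<^bsub>AA\<^esub>), 1) \<noteq> \<zero>\<^bsub>B\<^esub>"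
      by (simp add: zero_B)
    ultimately have "?N \<noteq> {\<zero>\<^bsub>B\<^esub>}"
      by blast
    then have N: "?N = carrier B"
      using simple displacement_ideal[OF i] unfolding simple_left_brace_def by blast
    have "v \<in> ?W" if v: "v \<in> carrier (V i)" for v
    proof -
      have "((single i v, \<one>\<^bsub>AA\<^esub>), 0) \<in> carrier B"
        using single_closed[OF v] AA_one p_gt_1 by (simp only: carrier_B) simp
      then have "((single i v, \<one>\<^bsub>AA\<^esub>), 0) \<in> ?N"
        using N by blast
      then show ?thesis
        using i by (simp add: single_def)
    qed
    then show "?W = carrier (V i)"
      using subgroup.subset[OF W] by blast
  qed
qed

end

theorem theorem5p7:
  fixes p s :: nat
    and n l :: "nat \<Rightarrow> nat"
    and bf :: "nat \<Rightarrow> (nat \<Rightarrow> int) \<Rightarrow> (nat \<Rightarrow> int) \<Rightarrow> int"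
    and f c :: "nat \<Rightarrow> (nat \<Rightarrow> int) \<Rightarrow> nat \<Rightarrow> int"
    and \<gamma> :: "nat \<Rightarrow> int"
  assumes "\<And>i. i \<in> {1..s} \<Longrightarrow> l i > 0"
    and "Factorial_Ring.prime p"
    and "\<And>q::nat. Factorial_Ring.prime q \<Longrightarrow>
           q dvd order (product_group {1..s} (\<lambda>i. integer_mod_group (l i))) \<Longrightarrow> p dvd q - 1"
    and "\<And>i. i \<in> {1..s} \<Longrightarrow> symmetric_bilinear_form p (n i) (bf i)"
    and "\<And>i. i \<in> {1..s} \<Longrightarrow> nondegenerate_form p (n i) (bf i)"
    and "\<And>i. i \<in> {1..s} \<Longrightarrow> f i \<in> carrier (orthogonal_group p (n i) (bf i))"
    and "\<And>i. i \<in> {1..s} \<Longrightarrow> group.ord (orthogonal_group p (n i) (bf i)) (f i) = p"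
    and "\<And>i. i \<in> {1..s} \<Longrightarrow> c i \<in> carrier (orthogonal_group p (n i) (bf i))"
    and "\<And>i. i \<in> {1..s} \<Longrightarrow> group.ord (orthogonal_group p (n i) (bf i)) (c i) = l i"
    and "\<And>i. i \<in> {1..s} \<Longrightarrow> \<gamma> i \<in> Units (residue_ring (int (l i)))"
    and "\<And>i. i \<in> {1..s} \<Longrightarrow> group.ord (units_of (residue_ring (int (l i)))) (\<gamma> i) = p"
    and "\<And>i. i \<in> {1..s} \<Longrightarrow>
           f i \<otimes>\<^bsub>orthogonal_group p (n i) (bf i)\<^esub> c i =
           (c i [^]\<^bsub>orthogonal_group p (n i) (bf i)\<^esub> \<gamma> i) \<otimes>\<^bsub>orthogonal_group p (n i) (bf i)\<^esub> f i"
    and "\<And>i. i \<in> {1..s} \<Longrightarrow>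
           \<gamma> i \<ominus>\<^bsub>residue_ring (int (l i))\<^esub> \<one>\<^bsub>residue_ring (int (l i))\<^esub>
             \<in> Units (residue_ring (int (l i)))"
  shows "left_brace (brace_B p s n l bf f c \<gamma>) \<and>
    (simple_left_brace (brace_B p s n l bf f c \<gamma>) \<longleftrightarrow>
       (\<forall>i\<in>{1..s}.
          (minus_id p (n i) (c i) ` carrier (zp_space p (n i)))
            <#>\<^bsub>zp_space p (n i)\<^esub> (minus_id p (n i) (f i) ` carrier (zp_space p (n i)))
          = carrier (zp_space p (n i)))) \<and>
    ((\<forall>i\<in>{1..s}. minus_id p (n i) (c i) \<in> auto (zp_space p (n i))) \<longrightarrow>
       simple_left_brace (brace_B p s n l bf f c \<gamma>))"
proof -
  interpret orthogonal_brace p s n l bf f c \<gamma>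
    by unfold_locales (use assms in \<open>auto intro!: metacyclic_isometries.intro\<close>)
  have "displacement p (n i) (c i) (f i) = carrier (V i)"
    if "i \<in> {1..s}" "minus_id p (n i) (c i) \<in> auto (V i)" for i
    using metacyclic_isometries.displacement_eq_carrierI[OF factor] that by blast
  then show ?thesis
    using left_brace_B simple_iff unfolding displacement_def by blast
qed

end
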